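(* Let $n\ge2$, $p\ge1$ and $m\ge 2p$. Let $\tilde Q$ be the canonical projection of $\mathcal{P}_m(\mathbb{C}^n)$ onto $\mathcal{H}_m^p(\mathbb{C}^n)$, and for $u\in\mathcal{P}_m(\mathbb{C}^n)$ let $u_0,\dots,u_{[m/2]}$ be the polynomials associated with $u|_{\mathbb{R}^n}$ as described in the context. Then the mapping $$\tilde Q|_{\widehat S_p}\colon\mathcal{P}_m(\mathbb{C}^n)|_{\widehat S_p}\to\mathcal{H}_m^p(\widehat S_p),\qquad u|_{\widehat S_p}\mapsto \tilde Q[u]|_{\widehat S_p},$$ is the orthogonal projection of $\mathcal{P}_m(\mathbb{C}^n)|_{\widehat S_p}$ onto $\mathcal{H}_m^p(\widehat S_p)$ (with respect to the inner product of $L^2(\widehat S_p)$), and it is given by $$\tilde Q|_{\widehat S_p}[u|_{\widehat S_p}](z)=\begin{cases}\displaystyle e^{iml\pi/p}\sum_{k=0}^{p-1}\frac{u_k(D)|x|^{2-n}}{c_{m-2k}} & \text{for } n>2,\\[3mm] \displaystyle e^{iml\pi/p}\sum_{k=0}^{p-1}\frac{u_k(D)\log|x|}{\tilde c_{m-2k}} & \text{for } n=2,\end{cases}$$ where $z\in\widehat S_p\subset\mathbb{C}^n$ and $z=e^{il\pi/p}x$ with $l\in\{0,\dots,p-1\}$ and $x\in S$.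
   Context: $S$ is the unit sphere in $\mathbb{R}^n$ and $\widehat S_p=\bigcup_{l=0}^{p-1}e^{l\pi i/p}S\subset\mathbb{C}^n$. $\mathcal{P}_m(\mathbb{R}^n)$, $\mathcal{P}_m(\mathbb{C}^n)$ are the spaces of homogeneous polynomials of degree $m$ on $\mathbb{R}^n$, $\mathbb{C}^n$ (complex coefficients, including zero); $\mathcal{H}_m^p(\mathbb{C}^n)$ is the subspace of those $q\in\mathcal{P}_m(\mathbb{C}^n)$ with $\Delta^pq=0$, $\Delta=\sum_j\partial^2/\partial z_j^2$. $\mathcal{P}_m(\mathbb{C}^n)|_{\widehat S_p}$ and $\mathcal{H}_m^p(\widehat S_p)$ (spherical polyharmonics of degree $m$ and order $p$) are the spaces of restrictions to $\widehat S_p$ of elements of $\mathcal{P}_m(\mathbb{C}^n)$ and $\mathcal{H}_m^p(\mathbb{C}^n)$. The canonical projection $\tilde Q$ is the projection onto the first summand in $\mathcal{P}_m(\mathbb{C}^n)=\mathcal{H}_m^p(\mathbb{C}^n)\oplus|z|^{2p}\mathcal{P}_{m-2p}(\mathbb{C}^n)$, where $|z|^2=\sum_jz_j^2$. The inner product on $L^2(\widehat S_p)$ is $$\langle f,g\rangle_{\widehat S_p}=\frac1p\int_S\sum_{j=0}^{p-1}f(e^{j\pi i/p}\zeta)\overline{g(e^{j\pi i/p}\zeta)}\,d\sigma(\zeta),$$ with $\sigma$ the normalized surface measure on $S$. $\mathbb{N}_0=\{0,1,2,\dots\}$; $[\cdot]$ is the integer part. For $w=\sum_\alpha a_\alpha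 x^\alpha$, $w(D)=\sum_\alpha a_\alpha D^\alpha$; $u_k(D)|x|^{2-n}$ (resp. $u_k(D)\log|x|$) denotes the value at $x$ of $u_k(D)$ applied to the function $y\mapsto|y|^{2-n}$ (resp. $y\mapsto\log|y|$) on $\mathbb{R}^n\setminus\{0\}$. $D^{2k}_{x_1^{2k_1},\dots,x_n^{2k_n}}u=\partial^{2k}u/\partial x_1^{2k_1}\cdots\partial x_n^{2k_n}$. The Kelvin transform is $K[f](x)=|x|^{2-n}f(x/|x|^2)$. $c_m=\prod_{k=0}^{m-1}(2-n-2k)$ and, for $m\ge1$, $\tilde c_m=(-2)^{m-1}(m-1)!$. The polynomials $u_k$: there exist constants $d_{m,k,k_1,\dots,k_n}$, independent of $u$, such that for every $u\in\mathcal{P}_m(\mathbb{R}^n)$, with $u_0=u$ and $$u_k=\sum_{\substack{(k_1,\dots,k_n)\in\mathbb{N}_0^n\\ k_1+\dots+k_n=k}}d_{m,k,k_1,\dots,k_n}D^{2k}_{x_1^{2k_1},\dots,x_n^{2k_n}}u\quad (1\le k\le[m/2]),$$ one has $u(x)=\sum_{k=0}^{[m/2]}\frac{|x|^{2k}}{c_{m-2k}}K[u_k(D)|x|^{2-n}]$ if $n>2$, and $u(x)=\sum_{k=0}^{[m/2]}\frac{|x|^{2k}}{\tilde c_{m-2k}}K[u_k(D)\log|x|]$ if $n=2$ (where, for $m$ even and $n=2$, the term $k=m/2$ is read as $|x|^m u_{m/2}$). Such constants are fixed once and for all. *)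

theory Defs
  imports "HOL-Probability.Probability"
begin

section \<open>Partial derivatives\<close>

definition partial :: "'n \<Rightarrow> (real^'n \<Rightarrow> complex) \<Rightarrow> real^'n \<Rightarrow> complex" where
  "partial i f x = vector_derivative (\<lambda>t. f (x + t *\<^sub>R axis i 1)) (at 0)"

definition coord_list :: "'n::finite list" where
  "coord_list = (SOME xs. distinct xs \<and> set xs = UNIV)"

text \<open>The derivative \<open>D\<^sup>\<alpha>\<close> for a multi-index \<open>\<alpha>\<close>. The partial derivatives are composed in an
  arbitrary but fixed order of the coordinates, which is immaterial near every point where the
  function is smooth.\<close>

definition multi_deriv :: "('n::finite \<Rightarrow> nat) \<Rightarrow> (real^'n \<Rightarrow> complex) \<Rightarrow> real^'n \<Rightarrow> complex" where
  "multi_deriv \<alpha> f = foldr (\<lambda>i. partial i ^^ \<alpha> i) coord_list f"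

definition cpartial :: "'n \<Rightarrow> (complex^'n \<Rightarrow> complex) \<Rightarrow> complex^'n \<Rightarrow> complex" where
  "cpartial i f z = deriv (\<lambda>t. f (z + t *s axis i 1)) 0"

definition claplacian :: "(complex^'n::finite \<Rightarrow> complex) \<Rightarrow> complex^'n \<Rightarrow> complex" where
  "claplacian f z = (\<Sum>j\<in>UNIV. cpartial j (cpartial j f) z)"

section \<open>Polynomials\<close>

definition multi_power :: "'a::comm_semiring_1^'n::finite \<Rightarrow> ('n \<Rightarrow> nat) \<Rightarrow> 'a" where
  "multi_power x \<alpha> = (\<Prod>i\<in>UNIV. (x $ i) ^ \<alpha> i)"

definition multi_indices :: "nat \<Rightarrow> ('n::finite \<Rightarrow> nat) set" where
  "multi_indices m = {\<alpha>. (\<Sum>i\<in>UNIV. \<alpha> i) = m}"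

definition real_hom_polys :: "nat \<Rightarrow> (real^'n::finite \<Rightarrow> complex) set" where
  "real_hom_polys m =
     {u. \<exists>a. u = (\<lambda>x. \<Sum>\<alpha>\<in>multi_indices m. a \<alpha> * of_real (multi_power x \<alpha>))}"

definition hom_polys :: "nat \<Rightarrow> (complex^'n::finite \<Rightarrow> complex) set" where
  "hom_polys m = {u. \<exists>a. u = (\<lambda>z. \<Sum>\<alpha>\<in>multi_indices m. a \<alpha> * multi_power z \<alpha>)}"

definition polyharmonic_polys :: "nat \<Rightarrow> nat \<Rightarrow> (complex^'n::finite \<Rightarrow> complex) set" where
  "polyharmonic_polys p m = {q \<in> hom_polys m. (claplacian ^^ p) q = (\<lambda>z. 0)}"

text \<open>On \<open>\<complex>\<^sup>n\<close> the symbol \<open>|z|\<^sup>2\<close> stands for the holomorphic polynomial \<open>\<Sum>\<^sub>j z\<^sub>j\<^sup>2\<close>, not for the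
  squared Hermitian norm.\<close>

definition square_sum :: "complex^'n::finite \<Rightarrow> complex" where
  "square_sum z = (\<Sum>j\<in>UNIV. (z $ j)\<^sup>2)"

definition canonical_proj ::
  "nat \<Rightarrow> nat \<Rightarrow> (complex^'n::finite \<Rightarrow> complex) \<Rightarrow> complex^'n \<Rightarrow> complex" where
  "canonical_proj p m u =
     (THE h. h \<in> polyharmonic_polys p m \<and>
        (\<exists>q\<in>hom_polys (m - 2 * p). u = (\<lambda>z. h z + square_sum z ^ p * q z)))"

definition poly_coeffs :: "(real^'n::finite \<Rightarrow> complex) \<Rightarrow> ('n \<Rightarrow> nat) \<Rightarrow> complex" where
  "poly_coeffs w =
     (THE a. finite {\<alpha>. a \<alpha> \<noteq> 0} \<and>
        w = (\<lambda>x. \<Sum>\<alpha> | a \<alpha> \<noteq> 0. a \<alpha> * of_real (multi_power x \<alpha>)))"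

text \<open>The differential operator \<open>w(D)\<close> for a polynomial \<open>w\<close>.\<close>

definition poly_diff_op ::
  "(real^'n::finite \<Rightarrow> complex) \<Rightarrow> (real^'n \<Rightarrow> complex) \<Rightarrow> real^'n \<Rightarrow> complex" where
  "poly_diff_op w f x =
     (\<Sum>\<alpha> | poly_coeffs w \<alpha> \<noteq> 0. poly_coeffs w \<alpha> * multi_deriv \<alpha> f x)"

section \<open>The Kelvin transform and the polynomials \<open>u\<^sub>k\<close>\<close>

definition norm_power :: "real^'n::finite \<Rightarrow> complex" where
  "norm_power y = of_real (norm y powi (2 - int CARD('n)))"

definition log_norm :: "real^'n::finite \<Rightarrow> complex" where
  "log_norm y = of_real (ln (norm y))"

definition kelvin :: "(real^'n::finite \<Rightarrow> complex) \<Rightarrow> real^'n \<Rightarrow> complex" where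
  "kelvin f x = norm_power x * f (x /\<^sub>R (norm x)\<^sup>2)"

text \<open>The constants \<open>c\<^sub>m\<close> in dimension \<open>n\<close>, and their replacement in dimension 2 (for \<open>m \<ge> 1\<close>).\<close>

definition kelvin_c :: "nat \<Rightarrow> nat \<Rightarrow> real" where
  "kelvin_c n m = (\<Prod>k<m. 2 - real n - 2 * real k)"

definition kelvin_c2 :: "nat \<Rightarrow> real" where
  "kelvin_c2 m = (- 2) ^ (m - 1) * fact (m - 1)"

text \<open>For polynomials of a fixed degree \<open>m\<close>, \<open>d k \<kappa>\<close> is the constant
  \<open>d\<^bsub>m,k,k\<^sub>1,\<dots>,k\<^sub>n\<^esub>\<close> with \<open>\<kappa> = (k\<^sub>1,\<dots>,k\<^sub>n)\<close>.\<close>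

definition assoc_poly ::
  "(nat \<Rightarrow> ('n::finite \<Rightarrow> nat) \<Rightarrow> complex) \<Rightarrow> (real^'n \<Rightarrow> complex) \<Rightarrow> nat \<Rightarrow> real^'n \<Rightarrow> complex" where
  "assoc_poly d u k =
     (if k = 0 then u
      else (\<lambda>x. \<Sum>\<kappa>\<in>multi_indices k. d k \<kappa> * multi_deriv (\<lambda>i. 2 * \<kappa> i) u x))"

text \<open>The defining property of the constants in degree \<open>m\<close>. The expansion is required off the
  origin only, since the Kelvin transforms are functions on \<open>\<real>\<^sup>n - {0}\<close>.\<close>

definition kelvin_constants :: "nat \<Rightarrow> (nat \<Rightarrow> ('n::finite \<Rightarrow> nat) \<Rightarrow> complex) \<Rightarrow> bool" where
  "kelvin_constants m d \<longleftrightarrow>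
     (\<forall>u\<in>real_hom_polys m. \<forall>x::real^'n. x \<noteq> 0 \<longrightarrow>
        (CARD('n) > 2 \<longrightarrow>
           u x = (\<Sum>k\<le>m div 2. of_real (norm x ^ (2 * k) / kelvin_c CARD('n) (m - 2 * k))
                     * kelvin (poly_diff_op (assoc_poly d u k) norm_power) x)) \<and>
        (CARD('n) = 2 \<longrightarrow>
           u x = (\<Sum>k\<le>m div 2.
                    if 2 * k = m then of_real (norm x ^ m) * assoc_poly d u k x
                    else of_real (norm x ^ (2 * k) / kelvin_c2 (m - 2 * k))
                     * kelvin (poly_diff_op (assoc_poly d u k) log_norm) x)))"

section \<open>The union of rotated spheres and its inner product\<close>

definition cvec :: "real^'n::finite \<Rightarrow> complex^'n" where
  "cvec x = (\<chi> i. of_real (x $ i))"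

definition rotated_spheres :: "nat \<Rightarrow> (complex^'n::finite) set" where
  "rotated_spheres p = (\<Union>l<p. (\<lambda>x. cis (real l * pi / real p) *s cvec x) ` sphere 0 1)"

text \<open>Normalized surface measure on the unit sphere: the measure of \<open>A\<close> is the volume of the cone
  \<open>{r x | 0 < r < 1, x \<in> A}\<close> divided by the volume of the unit ball. Note that \<open>sgn x = x / |x|\<close>.\<close>

definition surface_measure :: "(real^'n::finite) measure" where
  "surface_measure =
     distr (restrict_space (uniform_measure lborel (ball 0 1)) (- {0}))
           (restrict_space borel (sphere 0 1)) sgn"

lemma sgn_measurable_sphere:
  "sgn \<in> restrict_space (uniform_measure lborel (ball 0 1)) (- {0}) \<rightarrow>\<^sub>M
     restrict_space borel (sphere 0 1 :: (real^'n::finite) set)"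
proof (rule measurable_restrict_space2)
  show "sgn \<in> space (restrict_space (uniform_measure lborel (ball 0 1)) (- {0 :: real^'n})) \<rightarrow> sphere 0 1"
    by (auto simp: space_restrict_space norm_sgn)
  have "sgn \<in> borel_measurable (borel :: (real^'n) measure)"
    unfolding sgn_div_norm[abs_def] by measurable
  then show "sgn \<in> restrict_space (uniform_measure lborel (ball 0 1)) (- {0}) \<rightarrow>\<^sub>M (borel :: (real^'n) measure)"
    by (intro measurable_restrict_space1) (simp cong: measurable_cong_sets)
qed

lemma prob_space_surface_measure: "prob_space (surface_measure :: (real^'n::finite) measure)"
proof -
  let ?U = "uniform_measure lborel (ball 0 1) :: (real^'n) measure"
  have "emeasure lborel (ball 0 1 :: (real^'n) set) \<noteq> 0" "emeasure lborel (ball 0 1 :: (real^'n) set) \<noteq> \<infinity>"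
    using emeasure_lborel_ball_finite[of "0::real^'n" 1] content_ball_pos[of 1 "0::real^'n"]
    by (auto simp: measure_def)
  then interpret prob_space ?U
    by (rule prob_space_uniform_measure)
  have "AE x in ?U. x \<in> - {0}"
    by (rule AE_uniform_measureI) (use AE_lborel_singleton[of "0::real^'n"] in auto)
  then have "prob_space (restrict_space ?U (- {0}))"
    by (intro prob_space_restrict_space) (simp_all add: emeasure_eq_measure AE_in_set_eq_1[symmetric])
  then show ?thesis
    unfolding surface_measure_def by (rule prob_space.prob_space_distr[OF _ sgn_measurable_sphere])
qed

definition spheres_inner ::
  "nat \<Rightarrow> (complex^'n::finite \<Rightarrow> complex) \<Rightarrow> (complex^'n \<Rightarrow> complex) \<Rightarrow> complex" where
  "spheres_inner p f g =
     1 / of_nat p * (\<integral>\<zeta>. (\<Sum>j<p. f (cis (real j * pi / real p) *s cvec \<zeta>)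
                              * cnj (g (cis (real j * pi / real p) *s cvec \<zeta>))) \<partial>surface_measure)"

text \<open>A function on a subset \<open>A\<close> is represented by its extension by zero, so that the vector space
  operations are pointwise.\<close>

definition restr :: "'a set \<Rightarrow> ('a \<Rightarrow> complex) \<Rightarrow> 'a \<Rightarrow> complex" where
  "restr A f = (\<lambda>z. if z \<in> A then f z else 0)"

definition hom_polys_spheres :: "nat \<Rightarrow> nat \<Rightarrow> (complex^'n::finite \<Rightarrow> complex) set" where
  "hom_polys_spheres p m = restr (rotated_spheres p) ` hom_polys m"

definition spherical_polyharmonics :: "nat \<Rightarrow> nat \<Rightarrow> (complex^'n::finite \<Rightarrow> complex) set" where
  "spherical_polyharmonics p m = restr (rotated_spheres p) ` polyharmonic_polys p m"

text \<open>\<open>T\<close> is the orthogonal projection of the function space \<open>V\<close> onto its subspace \<open>W\<close> with respect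
  to the inner product \<open>ip\<close>. Values of \<open>T\<close> outside \<open>V\<close> are irrelevant.\<close>

definition is_orthogonal_projection ::
  "(('a \<Rightarrow> complex) \<Rightarrow> ('a \<Rightarrow> complex) \<Rightarrow> complex) \<Rightarrow> ('a \<Rightarrow> complex) set \<Rightarrow> ('a \<Rightarrow> complex) set
     \<Rightarrow> (('a \<Rightarrow> complex) \<Rightarrow> 'a \<Rightarrow> complex) \<Rightarrow> bool" where
  "is_orthogonal_projection ip V W T \<longleftrightarrow>
     W \<subseteq> V \<and>
     (\<forall>f\<in>V. T f \<in> W) \<and>
     (\<forall>f\<in>V. \<forall>g\<in>V. \<forall>a b. T (\<lambda>z. a * f z + b * g z) = (\<lambda>z. a * T f z + b * T g z)) \<and>
     (\<forall>g\<in>W. T g = g) \<and>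
     (\<forall>f\<in>V. \<forall>g\<in>W. ip (\<lambda>z. f z - T f z) g = 0)"

end

theory Submission imports Defs begin

text \<open>Write \<open>s\<close> for the polynomial \<open>square_sum\<close> and \<open>n\<close> for the dimension. Three facts give the result.

First, the given constants produce an expansion of every \<open>u\<close> of degree \<open>m\<close> as
\<open>\<Sum>\<^sub>k s\<^sup>k v\<^sub>k\<close> with \<open>v\<^sub>k\<close> homogeneous of degree \<open>m - 2k\<close> and harmonic. Indeed every derivative
\<open>D\<^sup>\<alpha>\<close> of order \<open>j\<close> of \<open>|x|\<^bsup>2-n\<^esup>\<close> (or, for \<open>j \<ge> 1\<close>, of \<open>log |x|\<close> in the plane) has the form
\<open>|x|\<^bsup>2-n-2j\<^esup> p(x)\<close> with \<open>p\<close> a harmonic homogeneous polynomial of degree \<open>j\<close>, and the Kelvin transform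
turns this function into \<open>p\<close>; moreover it coincides with \<open>p\<close> on the unit sphere
(\<open>kelvin_harmonics_partial\<close>, \<open>kelvin_kelvin_harmonics\<close>, \<open>harmonic_expansion\<close>). Since \<open>\<Delta>\<^sup>p\<close> kills \<open>s\<^sup>k v\<^sub>k\<close>
for \<open>k < p\<close> and the remaining terms are divisible by \<open>s\<^sup>p\<close>, the part with \<open>k < p\<close> is a candidate for
the canonical projection of \<open>u\<close>. It is the canonical projection because no nonzero multiple of \<open>s\<^sup>p\<close>
is annihilated by \<open>\<Delta>\<^sup>p\<close> (\<open>no_polyharmonic_multiple_of_square_sum_power\<close>); homogeneity and \<open>s = 1\<close> on the
unit sphere turn it into the stated formula.

Second, on \<open>e\<^bsup>il\<pi>/p\<^esup>S\<close> the polynomial \<open>s\<close> is constantly \<open>e\<^bsup>2il\<pi>/p\<^esup>\<close>, so \<open>s\<^sup>p = 1\<close> on the whole union of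
rotated spheres. Hence \<open>u\<close> minus its projection restricts to a polynomial \<open>q\<close> of degree \<open>m - 2p\<close>, and
for \<open>h\<close> of degree \<open>m\<close> the rotations cancel in \<open>q\<close> times the conjugate of \<open>h\<close>, because the degrees
differ by \<open>2p\<close>. The inner product thus reduces to an integral over the real sphere
(\<open>spheres_inner_square_sum_multiple\<close>).

Third, if \<open>h\<close> is polyharmonic of order \<open>p\<close>, then on the real sphere it equals \<open>\<Sum>\<^bsub>k<p\<^esub> v\<^sub>k\<close> with \<open>v\<^sub>k\<close>
harmonic of degree \<open>m - 2k > m - 2p\<close>, and a harmonic polynomial is orthogonal to all polynomials of
lower degree (\<open>harmonic_orthogonal_lower_degree\<close>). Instead of Green's formula, the proof uses that the
surface measure is invariant under rotations: the integral of
\<open>z\<^sub>i \<partial>\<^sub>j f - z\<^sub>j \<partial>\<^sub>i f\<close> vanishes, and summing suitable instances of this identity gives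
\<open>\<integral> \<Delta>f = m (m + n - 2) \<integral> f\<close> for \<open>f\<close> of degree \<open>m\<close> (\<open>sphere_integral_claplacian\<close>).
The product of \<open>q\<close> and \<open>v\<close> has the Laplacian \<open>v \<Delta>q + 2 \<nabla>q \<cdot> \<nabla>v\<close>, whose terms have lower degree, so an induction
on the degree applies.\<close>

section \<open>Homogeneous polynomials\<close>

lemma finite_bounded_multi_indices:
  "finite {\<alpha> :: 'n::finite \<Rightarrow> nat. (\<Sum>i\<in>UNIV. \<alpha> i) \<le> N}"
proof (rule finite_subset)
  show "{\<alpha> :: 'n \<Rightarrow> nat. (\<Sum>i\<in>UNIV. \<alpha> i) \<le> N} \<subseteq> Pi\<^sub>E UNIV (\<lambda>_. {..N})"
  proof clarify
    fix \<alpha> :: "'n \<Rightarrow> nat" assume N: "(\<Sum>i\<in>UNIV. \<alpha> i) \<le> N"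
    have "\<alpha> i \<le> N" for i using member_le_sum[of i UNIV \<alpha>] N by simp
    then show "\<alpha> \<in> Pi\<^sub>E UNIV (\<lambda>_. {..N})" by (simp add: PiE_iff)
  qed
qed (simp add: finite_PiE)

lemma finite_multi_indices: "finite (multi_indices m :: ('n::finite \<Rightarrow> nat) set)"
  by (rule finite_subset[OF _ finite_bounded_multi_indices[of m]]) (auto simp: multi_indices_def)

lemma sum_bump: "(\<Sum>j\<in>UNIV. (\<alpha>(i := Suc (\<alpha> i))) j) = Suc (\<Sum>j\<in>UNIV. \<alpha> j)"
  for \<alpha> :: "'n::finite \<Rightarrow> nat"
proof -
  have "(\<Sum>j\<in>UNIV. (\<alpha>(i := Suc (\<alpha> i))) j) = (\<Sum>j\<in>UNIV. \<alpha> j + (if j = i then 1 else 0))"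
    by (intro sum.cong) auto
  then show ?thesis by (simp add: sum.distrib)
qed

lemma multi_power_bump: "multi_power x (\<alpha>(i := Suc (\<alpha> i))) = x $ i * multi_power x \<alpha>"
proof -
  have "multi_power x (\<alpha>(i := Suc (\<alpha> i))) = (\<Prod>j\<in>UNIV. (if j = i then x $ j else 1) * (x $ j) ^ \<alpha> j)"
    unfolding multi_power_def by (intro prod.cong) auto
  then show ?thesis by (simp add: prod.distrib multi_power_def)
qed

lemma unbump: "\<alpha> i \<noteq> 0 \<Longrightarrow> \<exists>\<beta>. \<alpha> = \<beta>(i := Suc (\<beta> i))" for \<alpha> :: "'n \<Rightarrow> nat"
  by (rule exI[of _ "\<alpha>(i := \<alpha> i - 1)"]) auto

lemma hom_polys_zero: "(\<lambda>z. 0) \<in> hom_polys m"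
  unfolding hom_polys_def by (auto intro!: exI[of _ "\<lambda>_. 0"])

lemma hom_polys_add: "f \<in> hom_polys m \<Longrightarrow> g \<in> hom_polys m \<Longrightarrow> (\<lambda>z. f z + g z) \<in> hom_polys m"
  unfolding hom_polys_def
  by clarify (rule_tac x="\<lambda>\<alpha>. a \<alpha> + aa \<alpha>" in exI, simp add: sum.distrib distrib_right)

lemma hom_polys_scale: "f \<in> hom_polys m \<Longrightarrow> (\<lambda>z. c * f z) \<in> hom_polys m"
  unfolding hom_polys_def
  by clarify (rule_tac x="\<lambda>\<alpha>. c * a \<alpha>" in exI, simp add: sum_distrib_left mult.assoc)

lemma hom_polys_diff: "f \<in> hom_polys m \<Longrightarrow> g \<in> hom_polys m \<Longrightarrow> (\<lambda>z. f z - g z) \<in> hom_polys m"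
  using hom_polys_add[of f m "\<lambda>z. (-1) * g z"] hom_polys_scale[of g m "-1"] by simp

lemma hom_polys_sum: "(\<And>k. k \<in> A \<Longrightarrow> f k \<in> hom_polys m) \<Longrightarrow> (\<lambda>z. \<Sum>k\<in>A. f k z) \<in> hom_polys m"
  by (induction A rule: infinite_finite_induct) (auto intro: hom_polys_zero hom_polys_add)

lemma hom_polys_monomial: "\<alpha> \<in> multi_indices m \<Longrightarrow> (\<lambda>z. multi_power z \<alpha>) \<in> hom_polys m"
  unfolding hom_polys_def
  by (auto intro!: exI[of _ "\<lambda>\<beta>. if \<beta> = \<alpha> then 1 else 0"]
      simp: finite_multi_indices if_distrib[of "\<lambda>t. t * _"] sum.delta cong: if_cong)

lemma hom_polys_const: "(\<lambda>z. c) \<in> hom_polys 0"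
proof -
  have "(\<lambda>z. c * multi_power z (\<lambda>_. 0)) \<in> (hom_polys 0 :: (complex^'n \<Rightarrow> complex) set)"
    by (intro hom_polys_scale hom_polys_monomial) (simp add: multi_indices_def)
  then show ?thesis by (simp add: multi_power_def)
qed

lemma hom_polys_var: assumes "f \<in> hom_polys m" shows "(\<lambda>z. z $ i * f z) \<in> hom_polys (Suc m)"
proof -
  obtain a where f: "f = (\<lambda>z. \<Sum>\<alpha>\<in>multi_indices m. a \<alpha> * multi_power z \<alpha>)"
    using assms by (auto simp: hom_polys_def)
  have "(\<lambda>z. \<Sum>\<alpha>\<in>multi_indices m. a \<alpha> * multi_power z (\<alpha>(i := Suc (\<alpha> i)))) \<in> hom_polys (Suc m)"
    by (intro hom_polys_sum hom_polys_scale hom_polys_monomial)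
      (simp add: multi_indices_def sum_bump del: fun_upd_apply)
  then show ?thesis
    unfolding f multi_power_bump sum_distrib_left by (simp add: mult_ac)
qed

text \<open>Splitting off one variable at a time makes most facts about polynomials, and in particular those
about \<open>cpartial\<close>, provable without coefficients.\<close>

lemma hom_polys_induct [consumes 1, case_names const add var]:
  assumes "f \<in> hom_polys m"
    and const: "\<And>c. P 0 (\<lambda>z. c)"
    and add: "\<And>m f g. f \<in> hom_polys m \<Longrightarrow> g \<in> hom_polys m \<Longrightarrow> P m f \<Longrightarrow> P m g \<Longrightarrow> P m (\<lambda>z. f z + g z)"
    and var: "\<And>m f i. f \<in> hom_polys m \<Longrightarrow> P m f \<Longrightarrow> P (Suc m) (\<lambda>z. z $ i * f z)"
  shows "P m (f :: complex^'n::finite \<Rightarrow> complex)"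
proof -
  have mono: "P m (\<lambda>z. c * multi_power z \<alpha>)" if "\<alpha> \<in> multi_indices m" for c \<alpha> m
    using that
  proof (induction m arbitrary: \<alpha>)
    case 0
    then have "\<alpha> = (\<lambda>_. 0)" by (auto simp: multi_indices_def)
    then show ?case using const[of c] by (simp add: multi_power_def)
  next
    case (Suc m)
    then obtain i where "\<alpha> i \<noteq> 0"
      by (metis (mono_tags, lifting) Zero_not_Suc mem_Collect_eq multi_indices_def sum.neutral)
    then obtain \<beta> where \<beta>: "\<alpha> = \<beta>(i := Suc (\<beta> i))" using unbump[of \<alpha> i] by metis
    have b: "\<beta> \<in> multi_indices m"
      using Suc.prems unfolding \<beta> multi_indices_def mem_Collect_eq sum_bump by simp
    have "P (Suc m) (\<lambda>z. z $ i * (c * multi_power z \<beta>))"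
      by (intro var Suc.IH b hom_polys_scale hom_polys_monomial)
    then show ?case unfolding \<beta> multi_power_bump by (simp add: mult_ac)
  qed
  have zero: "P m (\<lambda>z. 0)"
    using mono[of "\<lambda>i. if i = undefined then m else 0" m 0] by (simp add: multi_indices_def)
  obtain a where f: "f = (\<lambda>z. \<Sum>\<alpha>\<in>multi_indices m. a \<alpha> * multi_power z \<alpha>)"
    using assms(1) by (auto simp: hom_polys_def)
  have "P m (\<lambda>z. \<Sum>\<alpha>\<in>A. a \<alpha> * multi_power z \<alpha>)" if "finite A" "A \<subseteq> multi_indices m" for A
    using that
    by (induction A rule: finite_induct)
      (auto intro!: zero add mono hom_polys_scale hom_polys_monomial hom_polys_sum)
  then show ?thesis unfolding f using finite_multi_indices by blast
qed

lemma hom_polys_mult: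
  assumes "f \<in> hom_polys m" "g \<in> hom_polys k"
  shows "(\<lambda>z. f z * g z) \<in> hom_polys (m + k)"
  using assms(1)
proof (induction rule: hom_polys_induct)
  case (var m f i)
  then show ?case using hom_polys_var[OF var(2), of i] by (simp add: mult.assoc)
qed (auto simp: distrib_right intro: hom_polys_scale hom_polys_add assms(2))

lemma square_sum_hom: "square_sum \<in> hom_polys 2"
proof -
  have "(\<lambda>z. z $ j * (z $ j * 1)) \<in> (hom_polys (Suc (Suc 0)) :: (complex^'n \<Rightarrow> complex) set)" for j
    by (intro hom_polys_var hom_polys_const)
  then show ?thesis unfolding square_sum_def[abs_def] power2_eq_square
    by (intro hom_polys_sum) (simp add: numeral_2_eq_2)
qed

lemma square_sum_power_hom: "(\<lambda>z. square_sum z ^ k) \<in> hom_polys (2 * k)"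
proof (induction k)
  case (Suc k)
  then show ?case using hom_polys_mult[OF square_sum_hom Suc] by simp
qed (simp add: hom_polys_const)

lemma square_sum_power_mult_hom:
  "f \<in> hom_polys e \<Longrightarrow> 2 * k + e = m \<Longrightarrow> (\<lambda>z. square_sum z ^ k * f z) \<in> hom_polys m"
  using hom_polys_mult[OF square_sum_power_hom] by blast

lemma hom_polys_homogeneous: "f \<in> hom_polys m \<Longrightarrow> f (c *s z) = c ^ m * f z"
  by (induction rule: hom_polys_induct) (auto simp: algebra_simps)

lemma hom_polys_0D: "f \<in> hom_polys 0 \<Longrightarrow> \<exists>c. f = (\<lambda>z. c)"
  by (induction "0::nat" f rule: hom_polys_induct) auto

lemma continuous_cvec: "continuous_on A (f :: 'a::t2_space \<Rightarrow> real^'n::finite) \<Longrightarrow> continuous_on A (\<lambda>x. cvec (f x))"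
  unfolding cvec_def by (intro continuous_on_vec_lambda continuous_intros continuous_on_component)

lemma hom_polys_continuous: "f \<in> hom_polys m \<Longrightarrow> continuous_on UNIV f"
  by (induction rule: hom_polys_induct) (auto intro!: continuous_intros continuous_on_component)

section \<open>Partial derivatives of polynomials\<close>

lemma hom_polys_line_derivative:
  assumes "f \<in> hom_polys m"
  shows "((\<lambda>t. f (z + t *s axis i 1)) has_field_derivative cpartial i f z) (at 0)"
proof -
  have "(\<lambda>t. f (z + t *s axis i 1)) field_differentiable at 0"
    using assms
    by (induction rule: hom_polys_induct)
      (auto intro!: field_differentiable_add field_differentiable_mult derivative_intros)
  then show ?thesis
    unfolding cpartial_def by (simp add: field_differentiable_derivI)
qed

lemma cpartial_eqI:
  "((\<lambda>t. f (z + t *s axis i 1)) has_field_derivative D) (at 0) \<Longrightarrow> cpartial i f z = D"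
  unfolding cpartial_def by (rule DERIV_imp_deriv)

lemma cpartial_const [simp]: "cpartial i (\<lambda>z. c) = (\<lambda>z. 0)"
  by (rule ext, rule cpartial_eqI) (auto intro!: derivative_eq_intros)

lemma cpartial_add:
  assumes "f \<in> hom_polys m" "g \<in> hom_polys k"
  shows "cpartial i (\<lambda>z. f z + g z) = (\<lambda>z. cpartial i f z + cpartial i g z)"
  by (rule ext, rule cpartial_eqI, rule DERIV_add)
    (rule hom_polys_line_derivative[OF assms(1)] hom_polys_line_derivative[OF assms(2)])+

lemma cpartial_mult:
  assumes "f \<in> hom_polys m" "g \<in> hom_polys k"
  shows "cpartial i (\<lambda>z. f z * g z) = (\<lambda>z. cpartial i f z * g z + f z * cpartial i g z)"
  by (rule ext, rule cpartial_eqI)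
    (auto intro!: derivative_eq_intros hom_polys_line_derivative assms)

lemma cpartial_scale:
  "f \<in> hom_polys m \<Longrightarrow> cpartial i (\<lambda>z. c * f z) = (\<lambda>z. c * cpartial i f z)"
  using cpartial_mult[OF hom_polys_const] by simp

lemma coordinate_hom: "(\<lambda>z. z $ k) \<in> hom_polys 1"
  using hom_polys_var[OF hom_polys_const[of 1]] by simp

lemma cpartial_coordinate: "cpartial i (\<lambda>z. z $ k) = (\<lambda>z. if i = k then 1 else 0)"
  by (rule ext, rule cpartial_eqI) (auto simp: axis_def intro!: derivative_eq_intros)

lemma cpartial_var:
  assumes "f \<in> hom_polys m"
  shows "cpartial i (\<lambda>z. z $ k * f z) = (\<lambda>z. (if i = k then f z else 0) + z $ k * cpartial i f z)"
  unfolding cpartial_mult[OF coordinate_hom assms] cpartial_coordinate by auto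

lemma cpartial_hom: "f \<in> hom_polys m \<Longrightarrow> cpartial i f \<in> hom_polys (m - 1)"
proof (induction rule: hom_polys_induct)
  case (const c)
  then show ?case by (simp add: hom_polys_zero)
next
  case (add m f g)
  then show ?case by (simp add: cpartial_add[OF add(1,2)] hom_polys_add)
next
  case (var m f k)
  have "(\<lambda>z. z $ k * cpartial i f z) \<in> hom_polys m"
  proof (cases m)
    case 0
    then obtain c where "f = (\<lambda>z. c)" using var hom_polys_0D by blast
    then show ?thesis by (simp add: hom_polys_zero)
  next
    case (Suc l)
    then show ?thesis using hom_polys_var[OF var(2), of k] by simp
  qed
  moreover have "(\<lambda>z. if i = k then f z else 0) \<in> hom_polys m"
    using var by (cases "i = k") (simp_all add: hom_polys_zero)
  ultimately show ?case by (simp add: cpartial_var[OF var(1)] hom_polys_add)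
qed

lemma cpartial_sum:
  assumes "\<And>k. k \<in> A \<Longrightarrow> f k \<in> hom_polys m"
  shows "cpartial i (\<lambda>z. \<Sum>k\<in>A. f k z) = (\<lambda>z. \<Sum>k\<in>A. cpartial i (f k) z)"
  using assms
proof (induction A rule: infinite_finite_induct)
  case (insert a A)
  then show ?case using cpartial_add[of "f a" m "\<lambda>z. \<Sum>k\<in>A. f k z" m i] hom_polys_sum[of A f m] by auto
qed auto

lemma cpartial_commute:
  "f \<in> hom_polys m \<Longrightarrow> cpartial i (cpartial j f) = cpartial j (cpartial i f)"
proof (induction rule: hom_polys_induct)
  case (add m f g)
  then show ?case
    by (simp add: cpartial_add[OF add(1,2)] cpartial_add[OF cpartial_hom[OF add(1)] cpartial_hom[OF add(2)]])
next
  case (var m f k)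
  have *: "cpartial i (\<lambda>z. (if j = k then f z else 0) + z $ k * cpartial j f z)
      = (\<lambda>z. (if j = k then cpartial i f z else 0) + ((if i = k then cpartial j f z else 0) + z $ k * cpartial i (cpartial j f) z))"
    for i j
  proof -
    have h: "(\<lambda>z. if j = k then f z else 0) \<in> hom_polys m"
      using var by (cases "j = k") (simp_all add: hom_polys_zero)
    have d: "cpartial i (\<lambda>z. if j = k then f z else 0) = (\<lambda>z. if j = k then cpartial i f z else 0)"
      by (cases "j = k") auto
    show ?thesis
      unfolding cpartial_add[OF h hom_polys_var[OF cpartial_hom[OF var(1)]]] d
        cpartial_var[OF cpartial_hom[OF var(1)]] ..
  qed
  show ?case unfolding cpartial_var[OF var(1)] * var(2) by (auto simp: add_ac)
qed simp

lemma euler_identity: "f \<in> hom_polys m \<Longrightarrow> (\<Sum>j\<in>UNIV. z $ j * cpartial j f z) = of_nat m * f z"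
proof (induction rule: hom_polys_induct)
  case (add m f g)
  then show ?case by (simp add: cpartial_add[OF add(1,2)] distrib_left sum.distrib)
next
  case (var m f k)
  have "(\<Sum>j\<in>UNIV. z $ j * (if j = k then f z else 0)) = z $ k * f z"
    by (simp add: if_distrib[of "(*) _"] cong: if_cong)
  moreover have "(\<Sum>j\<in>UNIV. z $ j * (z $ k * cpartial j f z)) = z $ k * (\<Sum>j\<in>UNIV. z $ j * cpartial j f z)"
    by (simp add: sum_distrib_left mult_ac)
  ultimately have "(\<Sum>j\<in>UNIV. z $ j * ((if j = k then f z else 0) + z $ k * cpartial j f z))
      = z $ k * f z + z $ k * (of_nat m * f z)"
    by (simp only: distrib_left sum.distrib var(2))
  also have "\<dots> = of_nat (Suc m) * (z $ k * f z)" by (simp add: algebra_simps)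
  finally show ?case unfolding cpartial_var[OF var(1)] .
qed simp

section \<open>The Laplacian on polynomials\<close>

lemma claplacian_hom: "f \<in> hom_polys m \<Longrightarrow> claplacian f \<in> hom_polys (m - 2)"
  unfolding claplacian_def[abs_def]
  using cpartial_hom[OF cpartial_hom[of f m]] by (intro hom_polys_sum) (simp add: numeral_2_eq_2)

lemma claplacian_add:
  assumes "f \<in> hom_polys m" "g \<in> hom_polys k"
  shows "claplacian (\<lambda>z. f z + g z) = (\<lambda>z. claplacian f z + claplacian g z)"
  unfolding claplacian_def[abs_def]
  by (simp add: cpartial_add[OF assms] cpartial_add[OF cpartial_hom[OF assms(1)] cpartial_hom[OF assms(2)]] sum.distrib)

lemma claplacian_scale:
  assumes "f \<in> hom_polys m" shows "claplacian (\<lambda>z. c * f z) = (\<lambda>z. c * claplacian f z)"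
  unfolding claplacian_def[abs_def]
  by (simp add: cpartial_scale[OF assms] cpartial_scale[OF cpartial_hom[OF assms(1)]] sum_distrib_left)

lemma claplacian_const [simp]: "claplacian (\<lambda>z. c) = (\<lambda>z. 0)"
  by (simp add: claplacian_def[abs_def])

lemma claplacian_cpartial:
  assumes "f \<in> hom_polys m" shows "claplacian (cpartial i f) = cpartial i (claplacian f)"
  unfolding claplacian_def[abs_def]
  by (simp add: cpartial_sum[of UNIV "\<lambda>j. cpartial j (cpartial j f)", OF cpartial_hom[OF cpartial_hom[OF assms]]]
     cpartial_commute[OF assms, of _ i] cpartial_commute[OF cpartial_hom[OF assms], of _ i])

lemma claplacian_mult:
  assumes f: "f \<in> hom_polys m" and g: "g \<in> hom_polys k"
  shows "claplacian (\<lambda>z. f z * g z) z = f z * claplacian g z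
      + 2 * (\<Sum>j\<in>UNIV. cpartial j f z * cpartial j g z) + claplacian f z * g z"
proof -
  have "cpartial j (cpartial j (\<lambda>z. f z * g z)) z = f z * cpartial j (cpartial j g) z
      + 2 * (cpartial j f z * cpartial j g z) + cpartial j (cpartial j f) z * g z" for j
    unfolding cpartial_mult[OF f g]
      cpartial_add[OF hom_polys_mult[OF cpartial_hom[OF f] g] hom_polys_mult[OF f cpartial_hom[OF g]]]
      cpartial_mult[OF cpartial_hom[OF f] g] cpartial_mult[OF f cpartial_hom[OF g]]
    by simp
  then show ?thesis
    unfolding claplacian_def by (simp add: sum.distrib sum_distrib_left sum_distrib_right)
qed

lemma cpartial_square_sum: "cpartial i square_sum = (\<lambda>z. 2 * z $ i)"
proof -
  have "cpartial i square_sum = cpartial i (\<lambda>z. \<Sum>j\<in>UNIV. z $ j * z $ j)"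
    by (simp add: square_sum_def[abs_def] power2_eq_square)
  also have "\<dots> = (\<lambda>z. \<Sum>j\<in>UNIV. cpartial i (\<lambda>z. z $ j * z $ j) z)"
    by (intro cpartial_sum[where m="1+1"] hom_polys_mult coordinate_hom)
  also have "\<dots> = (\<lambda>z. \<Sum>j\<in>UNIV. if i = j then 2 * z $ j else 0)"
    by (intro ext sum.cong) (auto simp: cpartial_var[OF coordinate_hom] cpartial_coordinate)
  finally show ?thesis by simp
qed

lemma claplacian_square_sum: "claplacian square_sum = (\<lambda>z::complex^'n::finite. 2 * of_nat CARD('n))"
proof -
  have "cpartial i (\<lambda>z. 2 * z $ i) = (\<lambda>z::complex^'n. 2)" for i
    using cpartial_scale[OF coordinate_hom, of i 2 i] by (simp add: cpartial_coordinate)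
  then show ?thesis by (simp add: claplacian_def[abs_def] cpartial_square_sum mult.commute)
qed

text \<open>The middle term of the product rule is \<open>4 \<Sum>\<^sub>j z\<^sub>j \<partial>\<^sub>j f = 4 e f\<close> by Euler's identity.\<close>

lemma claplacian_square_sum_mult:
  fixes f :: "complex^'n::finite \<Rightarrow> complex"
  assumes "f \<in> hom_polys e"
  shows "claplacian (\<lambda>z. square_sum z * f z) =
     (\<lambda>z. square_sum z * claplacian f z + of_nat (4 * e + 2 * CARD('n)) * f z)"
proof
  fix z
  have "(\<Sum>j\<in>UNIV. cpartial j square_sum z * cpartial j f z) = 2 * (of_nat e * f z)"
    by (simp add: cpartial_square_sum sum_distrib_left euler_identity[OF assms, symmetric] mult.assoc)
  then show "claplacian (\<lambda>z. square_sum z * f z) z =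
     square_sum z * claplacian f z + of_nat (4 * e + 2 * CARD('n)) * f z"
    by (simp add: claplacian_mult[OF square_sum_hom assms] claplacian_square_sum algebra_simps)
qed

text \<open>The natural-number subtraction in the factor is harmless: for \<open>k = 0\<close> the factor vanishes, and for
\<open>k > 0\<close> one has \<open>2 * k \<ge> 2\<close>.\<close>

lemma claplacian_square_sum_power_mult:
  fixes f :: "complex^'n::finite \<Rightarrow> complex"
  assumes f: "f \<in> hom_polys e"
  shows "claplacian (\<lambda>z. square_sum z ^ k * f z) =
     (\<lambda>z. square_sum z ^ k * claplacian f z
        + of_nat (2 * k * (2 * e + 2 * k + CARD('n) - 2)) * (square_sum z ^ (k - 1) * f z))"
proof (induction k)
  case (Suc k)
  have h: "(\<lambda>z. square_sum z ^ k * f z) \<in> hom_polys (2 * k + e)"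
    by (rule square_sum_power_mult_hom[OF f]) simp
  have c: "2 * k * (2 * e + 2 * k + CARD('n) - 2) + (4 * (2 * k + e) + 2 * CARD('n))
      = 2 * Suc k * (2 * e + 2 * Suc k + CARD('n) - 2)"
    by (cases k; cases "CARD('n)") (auto simp: algebra_simps)
  show ?case
  proof
    fix z
    have "claplacian (\<lambda>z. square_sum z ^ Suc k * f z) z =
        square_sum z * (square_sum z ^ k * claplacian f z
          + of_nat (2 * k * (2 * e + 2 * k + CARD('n) - 2)) * (square_sum z ^ (k - 1) * f z))
        + of_nat (4 * (2 * k + e) + 2 * CARD('n)) * (square_sum z ^ k * f z)"
      unfolding power_Suc mult.assoc claplacian_square_sum_mult[OF h] Suc.IH ..
    moreover have "square_sum z * (of_nat (2 * k * (2 * e + 2 * k + CARD('n) - 2)) * (square_sum z ^ (k - 1) * f z))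
       = of_nat (2 * k * (2 * e + 2 * k + CARD('n) - 2)) * (square_sum z ^ k * f z)"
      by (cases k) simp_all
    ultimately show "claplacian (\<lambda>z. square_sum z ^ Suc k * f z) z = square_sum z ^ Suc k * claplacian f z
        + of_nat (2 * Suc k * (2 * e + 2 * Suc k + CARD('n) - 2)) * (square_sum z ^ (Suc k - 1) * f z)"
      unfolding c[symmetric] of_nat_add distrib_left distrib_right by simp
  qed
qed simp

lemma claplacian_funpow_zero [simp]: "(claplacian ^^ p) (\<lambda>z. 0) = (\<lambda>z. 0)"
  by (induction p) auto

lemma claplacian_funpow_hom: "f \<in> hom_polys m \<Longrightarrow> (claplacian ^^ p) f \<in> hom_polys (m - 2 * p)"
proof (induction p)
  case (Suc p)
  then show ?case using claplacian_hom[OF Suc.IH] by simp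
qed simp

lemma claplacian_funpow_add:
  assumes "f \<in> hom_polys m" "g \<in> hom_polys k"
  shows "(claplacian ^^ p) (\<lambda>z. f z + g z) = (\<lambda>z. (claplacian ^^ p) f z + (claplacian ^^ p) g z)"
  by (induction p) (auto simp: claplacian_add[OF claplacian_funpow_hom[OF assms(1)] claplacian_funpow_hom[OF assms(2)]])

lemma claplacian_funpow_scale:
  assumes "f \<in> hom_polys m"
  shows "(claplacian ^^ p) (\<lambda>z. c * f z) = (\<lambda>z. c * (claplacian ^^ p) f z)"
  by (induction p) (auto simp: claplacian_scale[OF claplacian_funpow_hom[OF assms(1)]])

section \<open>Polynomials are determined by their values on the real unit sphere\<close>

lemma multi_power_cvec: "multi_power (cvec x) \<alpha> = of_real (multi_power x \<alpha>)"
  by (simp add: multi_power_def cvec_def)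

lemma cvec_scaleR: "cvec (r *\<^sub>R x) = of_real r *s cvec x"
  by (simp add: cvec_def vec_eq_iff)

lemma square_sum_cvec: "square_sum (cvec x) = of_real ((norm x)\<^sup>2)"
  by (simp add: square_sum_def cvec_def norm_eq_sqrt_inner inner_vec_def power2_eq_square sum_nonneg)

lemma cpartial_monomial:
  "cpartial i (\<lambda>z :: complex^'n::finite. multi_power z \<alpha>)
    = (\<lambda>z. of_nat (\<alpha> i) * multi_power z (\<alpha>(i := \<alpha> i - 1)))"
proof
  fix z :: "complex^'n"
  define c where "c = (\<Prod>j\<in>UNIV - {i}. (z $ j) ^ \<alpha> j)"
  have 1: "multi_power (z + t *s axis i 1) \<alpha> = (z $ i + t) ^ \<alpha> i * c" for t
    unfolding multi_power_def c_def
    by (subst prod.remove[of UNIV i]) (auto simp: axis_def intro!: arg_cong2[of _ _ _ _ "(*)"] prod.cong)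
  have 2: "multi_power z (\<alpha>(i := \<alpha> i - 1)) = (z $ i) ^ (\<alpha> i - 1) * c"
    unfolding multi_power_def c_def
    by (subst prod.remove[of UNIV i]) (auto intro!: arg_cong2[of _ _ _ _ "(*)"] prod.cong)
  show "cpartial i (\<lambda>z. multi_power z \<alpha>) z = of_nat (\<alpha> i) * multi_power z (\<alpha>(i := \<alpha> i - 1))"
    unfolding 2 by (rule cpartial_eqI) (auto simp: 1 intro!: derivative_eq_intros)
qed

lemma real_line_derivative:
  assumes "f \<in> hom_polys m"
  shows "((\<lambda>t. f (cvec (x + t *\<^sub>R axis i 1))) has_vector_derivative cpartial i f (cvec x)) (at 0)"
proof -
  have "cvec (x + t *\<^sub>R axis i 1) = cvec x + of_real t *s axis i 1" for t
    by (simp add: cvec_def vec_eq_iff axis_def)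
  then show ?thesis
    using has_vector_derivative_real_field[of "\<lambda>t. f (cvec x + t *s axis i 1)" "cpartial i f (cvec x)" 0]
      hom_polys_line_derivative[OF assms, of "cvec x" i] by simp
qed

text \<open>Evaluation at the origin isolates the constant coefficient. The other coefficients are, up to nonzero
factors, coefficients of a first partial derivative, which vanishes identically and has smaller degree.
Polynomials with terms of different degrees are included because \<open>poly_coeffs\<close> quantifies over all
finitely supported coefficient families.\<close>

lemma coefficients_eq_zero:
  assumes "\<And>x :: real^'n::finite. (\<Sum>\<alpha> | (\<Sum>i\<in>UNIV. \<alpha> i) \<le> N. a \<alpha> * multi_power (cvec x) \<alpha>) = 0"
    and "(\<Sum>i\<in>UNIV. \<alpha> i) \<le> N"
  shows "a \<alpha> = 0"
  using assms
proof (induction N arbitrary: a \<alpha>)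
  have const: "a (\<lambda>_. 0) = 0"
    if "\<And>x :: real^'n. (\<Sum>\<alpha> | (\<Sum>i\<in>UNIV. \<alpha> i) \<le> N. a \<alpha> * multi_power (cvec x) \<alpha>) = 0" for N a
  proof -
    have mp: "multi_power (cvec (0 :: real^'n)) \<alpha> = (if \<alpha> = (\<lambda>_. 0) then 1 else 0)" for \<alpha>
      by (auto simp: multi_power_def cvec_def fun_eq_iff)
    have "(\<Sum>\<alpha> | (\<Sum>i\<in>UNIV. \<alpha> i) \<le> N. a \<alpha> * multi_power (cvec (0::real^'n)) \<alpha>)
        = (\<Sum>\<alpha> | (\<Sum>i\<in>UNIV. \<alpha> i) \<le> N. if \<alpha> = (\<lambda>_. 0) then a \<alpha> else 0)"
      by (intro sum.cong) (simp_all add: mp)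
    also have "\<dots> = a (\<lambda>_. 0)" by (simp add: finite_bounded_multi_indices)
    finally show ?thesis using that by simp
  qed
  {
    case 0
    then have "\<alpha> = (\<lambda>_. 0)" by auto
    moreover have "a (\<lambda>_. 0) = 0" by (rule const[OF 0(1)])
    ultimately show ?case by simp
  next
    case (Suc N)
    show ?case
    proof (cases "\<alpha> = (\<lambda>_. 0)")
      case True
      then show ?thesis using const[OF Suc.prems(1)] by simp
    next
      case False
      then obtain i where "\<alpha> i \<noteq> 0" by auto
      then obtain \<beta> where \<beta>: "\<alpha> = \<beta>(i := Suc (\<beta> i))" using unbump[of \<alpha> i] by metis
      define bump where "bump = (\<lambda>\<gamma> :: 'n \<Rightarrow> nat. \<gamma>(i := Suc (\<gamma> i)))"
      have sum_b: "(\<Sum>j\<in>UNIV. bump \<gamma> j) = Suc (\<Sum>j\<in>UNIV. \<gamma> j)" for \<gamma>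
        unfolding bump_def by (rule sum_bump)
      have inj: "inj bump"
        by (rule inj_on_inverseI[of _ "\<lambda>\<gamma>. \<gamma>(i := \<gamma> i - 1)"]) (simp add: bump_def)
      have img: "bump ` {\<gamma>. (\<Sum>j\<in>UNIV. \<gamma> j) \<le> N} = {\<gamma>. (\<Sum>j\<in>UNIV. \<gamma> j) \<le> Suc N \<and> \<gamma> i \<noteq> 0}"
      proof (intro equalityI subsetI)
        fix \<gamma> assume "\<gamma> \<in> {\<gamma>. (\<Sum>j\<in>UNIV. \<gamma> j) \<le> Suc N \<and> \<gamma> i \<noteq> 0}"
        moreover from this obtain \<delta> where "\<gamma> = bump \<delta>" using unbump[of \<gamma> i] unfolding bump_def by auto
        ultimately show "\<gamma> \<in> bump ` {\<gamma>. (\<Sum>j\<in>UNIV. \<gamma> j) \<le> N}" by (auto simp: sum_b)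
      qed (auto simp: sum_b, simp add: bump_def)
      have "(\<Sum>\<gamma> | (\<Sum>j\<in>UNIV. \<gamma> j) \<le> N. (a (bump \<gamma>) * of_nat (Suc (\<gamma> i))) * multi_power (cvec x) \<gamma>) = 0"
        for x :: "real^'n"
      proof -
        let ?D = "\<Sum>\<gamma> | (\<Sum>j\<in>UNIV. \<gamma> j) \<le> Suc N. a \<gamma> * (of_nat (\<gamma> i) * multi_power (cvec x) (\<gamma>(i := \<gamma> i - 1)))"
        have mono: "((\<lambda>t. multi_power (cvec (x + t *\<^sub>R axis i 1)) \<gamma>) has_vector_derivative
            of_nat (\<gamma> i) * multi_power (cvec x) (\<gamma>(i := \<gamma> i - 1))) (at 0)" for \<gamma>
          using real_line_derivative[OF hom_polys_monomial, of \<gamma> "\<Sum>j\<in>UNIV. \<gamma> j" x i]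
          by (simp add: multi_indices_def cpartial_monomial)
        have "((\<lambda>t. \<Sum>\<gamma> | (\<Sum>j\<in>UNIV. \<gamma> j) \<le> Suc N. a \<gamma> * multi_power (cvec (x + t *\<^sub>R axis i 1)) \<gamma>)
            has_vector_derivative ?D) (at 0)"
          by (intro has_vector_derivative_sum has_vector_derivative_mult_right mono)
        then have "((\<lambda>t. 0) has_vector_derivative ?D) (at 0)"
          by (simp add: Suc.prems(1))
        then have "?D = 0"
          using vector_derivative_unique_at[OF _ has_vector_derivative_const[of "0::complex"]] by blast
        moreover have "?D = (\<Sum>\<gamma>\<in>bump ` {\<gamma>. (\<Sum>j\<in>UNIV. \<gamma> j) \<le> N}. a \<gamma> * (of_nat (\<gamma> i) * multi_power (cvec x) (\<gamma>(i := \<gamma> i - 1))))"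
          unfolding img by (rule sum.mono_neutral_right) (auto simp: finite_bounded_multi_indices)
        moreover have "\<dots> = (\<Sum>\<gamma> | (\<Sum>j\<in>UNIV. \<gamma> j) \<le> N. (a (bump \<gamma>) * of_nat (Suc (\<gamma> i))) * multi_power (cvec x) \<gamma>)"
          by (subst sum.reindex[OF inj_on_subset[OF inj subset_UNIV]]) (simp add: bump_def mult.assoc)
        ultimately show ?thesis by simp
      qed
      moreover have "(\<Sum>j\<in>UNIV. \<beta> j) \<le> N" using Suc.prems(2) unfolding \<beta> sum_bump by simp
      ultimately have "a (bump \<beta>) * of_nat (Suc (\<beta> i)) = 0" by (rule Suc.IH)
      then have "a (bump \<beta>) = 0" unfolding mult_eq_0_iff of_nat_eq_0_iff by simp
      then show ?thesis unfolding \<beta> bump_def .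
    qed
  }
qed

lemma hom_polys_eq_on_reals:
  fixes f g :: "complex^'n::finite \<Rightarrow> complex"
  assumes "f \<in> hom_polys m" "g \<in> hom_polys m" "\<And>x :: real^'n. f (cvec x) = g (cvec x)"
  shows "f = g"
proof -
  obtain a where a: "(\<lambda>z. f z - g z) = (\<lambda>z. \<Sum>\<alpha>\<in>multi_indices m. a \<alpha> * multi_power z \<alpha>)"
    using hom_polys_diff[OF assms(1,2)] by (auto simp: hom_polys_def)
  have 0: "(\<Sum>\<alpha> | (\<Sum>i\<in>UNIV. \<alpha> i) \<le> m. (if \<alpha> \<in> multi_indices m then a \<alpha> else 0) * multi_power (cvec x) \<alpha>) = 0" for x :: "real^'n"
  proof -
    have "(\<Sum>\<alpha> | (\<Sum>i\<in>UNIV. \<alpha> i) \<le> m. (if \<alpha> \<in> multi_indices m then a \<alpha> else 0) * multi_power (cvec x) \<alpha>)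
      = (\<Sum>\<alpha>\<in>multi_indices m. a \<alpha> * multi_power (cvec x) \<alpha>)"
      by (rule sum.mono_neutral_cong_right) (auto simp: finite_bounded_multi_indices multi_indices_def)
    also have "\<dots> = 0" using fun_cong[OF a, of "cvec x"] assms(3)[of x] by simp
    finally show ?thesis .
  qed
  have "a \<alpha> = 0" if "\<alpha> \<in> multi_indices m" for \<alpha>
    using coefficients_eq_zero[OF 0, of \<alpha>] that by (simp add: multi_indices_def)
  then have "f z - g z = 0" for z using fun_cong[OF a, of z] by simp
  then show ?thesis by (auto simp: fun_eq_iff)
qed

text \<open>This makes the restriction of homogeneous polynomials to the rotated spheres injective, so that the
projection is well defined on restrictions.\<close>

lemma hom_polys_eq_on_sphere:
  fixes f g :: "complex^'n::finite \<Rightarrow> complex"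
  assumes f: "f \<in> hom_polys m" and g: "g \<in> hom_polys m"
    and eq: "\<And>x :: real^'n. norm x = 1 \<Longrightarrow> f (cvec x) = g (cvec x)"
  shows "f = g"
proof (rule hom_polys_eq_on_reals[OF f g])
  fix x :: "real^'n"
  obtain y where y: "norm y = 1" "x = norm x *\<^sub>R y"
  proof (cases "x = 0")
    case True
    then show ?thesis using that[of "axis undefined 1"] by simp
  next
    case False
    then show ?thesis using that[of "sgn x"] by (simp add: norm_sgn sgn_div_norm)
  qed
  show "f (cvec x) = g (cvec x)"
    by (subst (1 2) y(2)) (simp add: cvec_scaleR hom_polys_homogeneous[OF f] hom_polys_homogeneous[OF g] eq y(1))
qed

lemma real_hom_polys_eq_image: "real_hom_polys m = (\<lambda>f. f \<circ> cvec) ` hom_polys m"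
proof -
  have "(\<lambda>x. \<Sum>\<alpha>\<in>multi_indices m. a \<alpha> * of_real (multi_power x \<alpha>))
      = (\<lambda>z. \<Sum>\<alpha>\<in>multi_indices m. a \<alpha> * multi_power z \<alpha>) \<circ> cvec" for a
    by (simp add: fun_eq_iff multi_power_cvec)
  then show ?thesis unfolding real_hom_polys_def hom_polys_def by auto
qed

lemma poly_coeffs_eq:
  fixes a :: "('n::finite \<Rightarrow> nat) \<Rightarrow> complex"
  shows "poly_coeffs (\<lambda>x :: real^'n. \<Sum>\<alpha>\<in>multi_indices m. a \<alpha> * of_real (multi_power x \<alpha>))
     = (\<lambda>\<alpha>. if \<alpha> \<in> multi_indices m then a \<alpha> else 0)"
    (is "poly_coeffs ?w = ?a")
  unfolding poly_coeffs_def
proof (rule the_equality)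
  have fin: "finite {\<alpha>. ?a \<alpha> \<noteq> 0}"
    by (rule finite_subset[OF _ finite_multi_indices[of m]]) auto
  have w: "?w = (\<lambda>x. \<Sum>\<alpha> | ?a \<alpha> \<noteq> 0. ?a \<alpha> * of_real (multi_power x \<alpha>))"
    by (intro ext sum.mono_neutral_cong_right) (auto simp: finite_multi_indices)
  show "finite {\<alpha>. ?a \<alpha> \<noteq> 0} \<and> ?w = (\<lambda>x. \<Sum>\<alpha> | ?a \<alpha> \<noteq> 0. ?a \<alpha> * of_real (multi_power x \<alpha>))"
    using fin w by blast
  fix b assume b: "finite {\<alpha>. b \<alpha> \<noteq> 0} \<and> ?w = (\<lambda>x. \<Sum>\<alpha> | b \<alpha> \<noteq> 0. b \<alpha> * of_real (multi_power x \<alpha>))"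
  \<comment> \<open>any common bound for the degrees of \<open>?w\<close> and of the rival family \<open>b\<close> will do\<close>
  define N where "N = (\<Sum>\<alpha>\<in>{\<alpha>. b \<alpha> \<noteq> 0}. \<Sum>i\<in>UNIV. \<alpha> i) + m"
  have bN: "(\<Sum>i\<in>UNIV. \<alpha> i) \<le> N" if "b \<alpha> \<noteq> 0" for \<alpha>
    using member_le_sum[of \<alpha> "{\<alpha>. b \<alpha> \<noteq> 0}" "\<lambda>\<alpha>. \<Sum>i\<in>UNIV. \<alpha> i"] that b unfolding N_def by simp
  have aN: "(\<Sum>i\<in>UNIV. \<alpha> i) \<le> N" if "?a \<alpha> \<noteq> 0" for \<alpha>
    using that unfolding N_def by (auto simp: multi_indices_def split: if_splits)
  have "(\<Sum>\<alpha> | (\<Sum>i\<in>UNIV. \<alpha> i) \<le> N. (b \<alpha> - ?a \<alpha>) * multi_power (cvec x) \<alpha>) = 0" for x :: "real^'n"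
  proof -
    have "(\<Sum>\<alpha> | (\<Sum>i\<in>UNIV. \<alpha> i) \<le> N. b \<alpha> * multi_power (cvec x) \<alpha>)
        = (\<Sum>\<alpha> | b \<alpha> \<noteq> 0. b \<alpha> * of_real (multi_power x \<alpha>))"
      by (rule sum.mono_neutral_cong_right)
        (use bN in \<open>auto simp: finite_bounded_multi_indices multi_power_cvec\<close>)
    also have "\<dots> = ?w x" by (rule fun_cong[OF conjunct2[OF b], symmetric])
    finally have bN': "(\<Sum>\<alpha> | (\<Sum>i\<in>UNIV. \<alpha> i) \<le> N. b \<alpha> * multi_power (cvec x) \<alpha>) = ?w x" .
    have "(\<Sum>\<alpha> | (\<Sum>i\<in>UNIV. \<alpha> i) \<le> N. ?a \<alpha> * multi_power (cvec x) \<alpha>)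
        = (\<Sum>\<alpha> | ?a \<alpha> \<noteq> 0. ?a \<alpha> * of_real (multi_power x \<alpha>))"
      by (rule sum.mono_neutral_cong_right)
        (use aN in \<open>auto simp: finite_bounded_multi_indices multi_power_cvec\<close>)
    also have "\<dots> = ?w x" by (rule fun_cong[OF w, symmetric])
    finally have aN': "(\<Sum>\<alpha> | (\<Sum>i\<in>UNIV. \<alpha> i) \<le> N. ?a \<alpha> * multi_power (cvec x) \<alpha>) = ?w x" .
    show ?thesis unfolding left_diff_distrib sum_subtractf aN' bN' by simp
  qed
  note diff = coefficients_eq_zero[OF this]
  show "b = ?a"
  proof
    fix \<alpha> show "b \<alpha> = ?a \<alpha>"
      using diff[of \<alpha>] aN[of \<alpha>] bN[of \<alpha>] by (cases "(\<Sum>i\<in>UNIV. \<alpha> i) \<le> N") (force, metis)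
  qed
qed

lemma poly_diff_op_eq:
  fixes a :: "('n::finite \<Rightarrow> nat) \<Rightarrow> complex"
  shows "poly_diff_op (\<lambda>x :: real^'n. \<Sum>\<alpha>\<in>multi_indices m. a \<alpha> * of_real (multi_power x \<alpha>)) f x
     = (\<Sum>\<alpha>\<in>multi_indices m. a \<alpha> * multi_deriv \<alpha> f x)"
  unfolding poly_diff_op_def poly_coeffs_eq
  by (rule sum.mono_neutral_cong_left) (auto simp: finite_multi_indices)

section \<open>Uniqueness of the decomposition into a polyharmonic part and a multiple of a power of the square sum\<close>

lemma square_sum_power_cancel:
  fixes r :: "complex^'n::finite \<Rightarrow> complex"
  assumes "r \<in> hom_polys e" "(\<lambda>z. square_sum z ^ k * r z) = (\<lambda>z. 0)"
  shows "r = (\<lambda>z. 0)"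
proof (rule hom_polys_eq_on_sphere[OF assms(1) hom_polys_zero])
  fix x :: "real^'n" assume "norm x = 1"
  then show "r (cvec x) = 0" using fun_cong[OF assms(2), of "cvec x"] by (simp add: square_sum_cvec)
qed

lemma claplacian_low_degree:
  assumes "f \<in> hom_polys e" "e < 2" shows "claplacian f = (\<lambda>z. 0)"
proof -
  have "cpartial j f \<in> hom_polys 0" for j using cpartial_hom[OF assms(1), of j] assms(2) by (cases e) auto
  then have "cpartial j (cpartial j f) = (\<lambda>z. 0)" for j using hom_polys_0D[of "cpartial j f"] by fastforce
  then show ?thesis by (simp add: claplacian_def[abs_def])
qed

lemma square_sum_claplacian_hom:
  assumes "f \<in> hom_polys e" shows "(\<lambda>z. square_sum z * claplacian f z) \<in> hom_polys e"
proof (cases "e < 2")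
  case True
  then show ?thesis using claplacian_low_degree[OF assms] by (simp add: hom_polys_zero)
next
  case False
  then show ?thesis using square_sum_power_mult_hom[OF claplacian_hom[OF assms], of 1 e] by simp
qed

lemma claplacian_square_sum_power_Suc_mult:
  fixes f :: "complex^'n::finite \<Rightarrow> complex"
  assumes f: "f \<in> hom_polys e"
  shows "claplacian (\<lambda>z. square_sum z ^ Suc k * f z) =
     (\<lambda>z. square_sum z ^ k * (square_sum z * claplacian f z
        + of_nat (2 * Suc k * (2 * e + 2 * k + CARD('n))) * f z))"
  unfolding claplacian_square_sum_power_mult[OF f] by (intro ext) (simp add: algebra_simps)

text \<open>If \<open>s\<^bsup>k+1\<^esup> r\<close> is harmonic, then expanding its Laplacian and cancelling \<open>s\<^sup>k\<close> shows that \<open>r\<close> is a nonzero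
constant times \<open>s \<Delta>r\<close>. So one more factor \<open>s\<close> can be split off, which lowers the degree of the
cofactor; this descent ends at \<open>r = 0\<close>.\<close>

lemma no_harmonic_multiple_of_square_sum:
  fixes r :: "complex^'n::finite \<Rightarrow> complex"
  assumes "r \<in> hom_polys e" "claplacian (\<lambda>z. square_sum z ^ Suc k * r z) = (\<lambda>z. 0)"
  shows "r = (\<lambda>z. 0)"
  using assms
proof (induction e arbitrary: k r rule: less_induct)
  case (less e)
  define C :: complex where "C = of_nat (2 * Suc k * (2 * e + 2 * k + CARD('n)))"
  have C: "C \<noteq> 0" unfolding C_def of_nat_eq_0_iff by simp
  have "(\<lambda>z. square_sum z * claplacian r z + C * r z) = (\<lambda>z. 0)"
    using less.prems(2) unfolding claplacian_square_sum_power_Suc_mult[OF less.prems(1)] C_def[symmetric]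
    by (rule square_sum_power_cancel[rotated, where e=e])
      (intro hom_polys_add hom_polys_scale square_sum_claplacian_hom less.prems(1))
  then have eq: "square_sum z * claplacian r z + C * r z = 0" for z by (rule fun_cong)
  show ?case
  proof (cases "e < 2")
    case True
    then show ?thesis using eq C by (simp add: claplacian_low_degree[OF less.prems(1)] fun_eq_iff)
  next
    case False
    define r' where "r' = (\<lambda>z. (- 1 / C) * claplacian r z)"
    have r: "r z = square_sum z * r' z" for z
      using eq[of z] C unfolding r'_def by (simp add: field_simps add_eq_0_iff)
    have r': "r' \<in> hom_polys (e - 2)"
      unfolding r'_def by (intro hom_polys_scale claplacian_hom less.prems(1))
    have "(\<lambda>z. square_sum z ^ Suc (Suc k) * r' z) = (\<lambda>z. square_sum z ^ Suc k * r z)"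
      by (simp add: r mult_ac)
    then have "r' = (\<lambda>z. 0)"
      using less.IH[of "e - 2" r' "Suc k"] False r' less.prems(2) by simp
    then show ?thesis by (simp add: r fun_eq_iff)
  qed
qed

text \<open>One Laplacian turns \<open>s\<^sup>k r\<close> into \<open>s\<^bsup>k-1\<^esup>\<close> times a polynomial of the same degree as \<open>r\<close>; by induction
that polynomial is zero, so \<open>s\<^sup>k r\<close> is already harmonic.\<close>

lemma no_polyharmonic_multiple_of_square_sum_power:
  fixes r :: "complex^'n::finite \<Rightarrow> complex"
  assumes "r \<in> hom_polys e" "(claplacian ^^ p) (\<lambda>z. square_sum z ^ k * r z) = (\<lambda>z. 0)" "p \<le> k"
  shows "r = (\<lambda>z. 0)"
  using assms
proof (induction p arbitrary: k r)
  case 0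
  then show ?case using square_sum_power_cancel by simp
next
  case (Suc p)
  then obtain k' where k: "k = Suc k'" by (cases k) auto
  let ?g = "\<lambda>z. square_sum z * claplacian r z + of_nat (2 * Suc k' * (2 * e + 2 * k' + CARD('n))) * r z"
  have lap: "claplacian (\<lambda>z. square_sum z ^ k * r z) = (\<lambda>z. square_sum z ^ k' * ?g z)"
    unfolding k by (rule claplacian_square_sum_power_Suc_mult[OF Suc.prems(1)])
  have "?g = (\<lambda>z. 0)"
  proof (rule Suc.IH)
    show "?g \<in> hom_polys e"
      by (intro hom_polys_add hom_polys_scale square_sum_claplacian_hom Suc.prems(1))
    show "(claplacian ^^ p) (\<lambda>z. square_sum z ^ k' * ?g z) = (\<lambda>z. 0)"
      using Suc.prems(2) unfolding funpow_Suc_right o_apply lap .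
  qed (use Suc.prems(3) k in simp)
  then have "claplacian (\<lambda>z. square_sum z ^ Suc k' * r z) = (\<lambda>z. 0)"
    using lap unfolding k by (simp add: fun_eq_iff)
  then show ?case by (rule no_harmonic_multiple_of_square_sum[OF Suc.prems(1)])
qed

lemma polyharmonic_decomposition_unique:
  fixes h h' q q' :: "complex^'n::finite \<Rightarrow> complex"
  assumes "h \<in> polyharmonic_polys p m" "h' \<in> polyharmonic_polys p m" "2 * p \<le> m"
    and q: "q \<in> hom_polys (m - 2 * p)" "q' \<in> hom_polys (m - 2 * p)"
    and eq: "(\<lambda>z. h z + square_sum z ^ p * q z) = (\<lambda>z. h' z + square_sum z ^ p * q' z)"
  shows "h = h'"
proof -
  have h: "h \<in> hom_polys m" "h' \<in> hom_polys m"
    "(claplacian ^^ p) h = (\<lambda>z. 0)" "(claplacian ^^ p) h' = (\<lambda>z. 0)"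
    using assms(1,2) by (auto simp: polyharmonic_polys_def)
  have d: "square_sum z ^ p * (q z - q' z) = h' z + (-1) * h z" for z
    using fun_cong[OF eq, of z] by (simp add: algebra_simps)
  have "(claplacian ^^ p) (\<lambda>z. square_sum z ^ p * (q z - q' z)) = (\<lambda>z. 0)"
    unfolding d claplacian_funpow_add[OF h(2) hom_polys_scale[OF h(1)]] claplacian_funpow_scale[OF h(1)] h
    by simp
  then have "(\<lambda>z. q z - q' z) = (\<lambda>z. 0)"
    by (rule no_polyharmonic_multiple_of_square_sum_power[OF hom_polys_diff[OF q]]) simp
  then have "q z - q' z = 0" for z by (rule fun_cong)
  then show ?thesis using d by (auto simp: fun_eq_iff)
qed

lemma canonical_proj_eqI:
  fixes u h q :: "complex^'n::finite \<Rightarrow> complex"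
  assumes "h \<in> polyharmonic_polys p m" "2 * p \<le> m" "q \<in> hom_polys (m - 2 * p)"
    and "u = (\<lambda>z. h z + square_sum z ^ p * q z)"
  shows "canonical_proj p m u = h"
  unfolding canonical_proj_def
proof (rule the_equality)
  fix h' assume "h' \<in> polyharmonic_polys p m \<and> (\<exists>q\<in>hom_polys (m - 2 * p). u = (\<lambda>z. h' z + square_sum z ^ p * q z))"
  then obtain q' where "h' \<in> polyharmonic_polys p m" "q' \<in> hom_polys (m - 2 * p)"
    "(\<lambda>z. h' z + square_sum z ^ p * q' z) = (\<lambda>z. h z + square_sum z ^ p * q z)"
    unfolding assms(4) by metis
  then show "h' = h"
    using polyharmonic_decomposition_unique[of h' p m h q' q] assms by simp
qed (use assms in blast)

text \<open>The Laplacian maps \<open>s\<^sup>k v\<close> to a multiple of \<open>s\<^bsup>k-1\<^esup> v\<close> and \<open>v\<close> to zero.\<close>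

lemma square_sum_power_harmonic_polyharmonic:
  assumes v: "v \<in> hom_polys e" "claplacian v = (\<lambda>z. 0)" and "k < p"
  shows "(claplacian ^^ p) (\<lambda>z. square_sum z ^ k * v z) = (\<lambda>z. 0)"
  using \<open>k < p\<close>
proof (induction p arbitrary: k)
  case (Suc p)
  have "(claplacian ^^ p) (\<lambda>z. square_sum z ^ (k - 1) * v z) = (\<lambda>z. 0)" if "k \<noteq> 0"
    using Suc that by simp
  then show ?case
    unfolding funpow_Suc_right o_apply claplacian_square_sum_power_mult[OF v(1)] v(2)
    using claplacian_funpow_scale[OF square_sum_power_mult_hom[OF v(1) refl]]
    by (cases "k = 0") simp_all
qed simp

lemma polyharmonic_polys_sum:
  assumes "\<And>k. k \<in> A \<Longrightarrow> f k \<in> polyharmonic_polys p m"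
  shows "(\<lambda>z. \<Sum>k\<in>A. f k z) \<in> polyharmonic_polys p m"
  using assms
proof (induction A rule: infinite_finite_induct)
  case (insert a A)
  then have "f a \<in> polyharmonic_polys p m" "(\<lambda>z. \<Sum>k\<in>A. f k z) \<in> polyharmonic_polys p m" by auto
  then have "(\<lambda>z. f a z + (\<Sum>k\<in>A. f k z)) \<in> polyharmonic_polys p m"
    unfolding polyharmonic_polys_def by (auto simp: claplacian_funpow_add intro: hom_polys_add)
  then show ?case using insert by simp
qed (auto simp: polyharmonic_polys_def hom_polys_zero)

text \<open>The terms with \<open>k < p\<close> are polyharmonic of order \<open>p\<close>, and the remaining ones contain the factor \<open>s\<^sup>p\<close>.\<close>

lemma canonical_proj_almansi:
  fixes u :: "complex^'n::finite \<Rightarrow> complex"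
  assumes m: "2 * p \<le> m"
    and v: "\<And>k. 2 * k \<le> m \<Longrightarrow> v k \<in> hom_polys (m - 2 * k)"
    and harm: "\<And>k. k < p \<Longrightarrow> claplacian (v k) = (\<lambda>z. 0)"
    and u: "u = (\<lambda>z. \<Sum>k\<le>m div 2. square_sum z ^ k * v k z)"
  obtains q where "q \<in> hom_polys (m - 2 * p)"
    "(\<lambda>z. \<Sum>k<p. square_sum z ^ k * v k z) \<in> polyharmonic_polys p m"
    "u = (\<lambda>z. (\<Sum>k<p. square_sum z ^ k * v k z) + square_sum z ^ p * q z)"
    "canonical_proj p m u = (\<lambda>z. \<Sum>k<p. square_sum z ^ k * v k z)"
proof
  define q where "q = (\<lambda>z. \<Sum>k\<in>{p..m div 2}. square_sum z ^ (k - p) * v k z)"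
  show q: "q \<in> hom_polys (m - 2 * p)"
    unfolding q_def
  proof (rule hom_polys_sum)
    fix k assume "k \<in> {p..m div 2}"
    then have "p \<le> k" "2 * k \<le> m" by auto
    then show "(\<lambda>z. square_sum z ^ (k - p) * v k z) \<in> hom_polys (m - 2 * p)"
      by (intro square_sum_power_mult_hom[OF v]) auto
  qed
  show h: "(\<lambda>z. \<Sum>k<p. square_sum z ^ k * v k z) \<in> polyharmonic_polys p m"
  proof (rule polyharmonic_polys_sum)
    fix k assume "k \<in> {..<p}"
    then have k: "k < p" "2 * k \<le> m" using m by auto
    then show "(\<lambda>z. square_sum z ^ k * v k z) \<in> polyharmonic_polys p m"
      unfolding polyharmonic_polys_def
      using square_sum_power_mult_hom[OF v[OF k(2)], of k m]
        square_sum_power_harmonic_polyharmonic[OF v[OF k(2)] harm[OF k(1)] k(1)] by simp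
  qed
  show eq: "u = (\<lambda>z. (\<Sum>k<p. square_sum z ^ k * v k z) + square_sum z ^ p * q z)"
  proof
    fix z
    have *: "{..m div 2} = {..<p} \<union> {p..m div 2}" using m by auto
    have "square_sum z ^ p * q z = (\<Sum>k\<in>{p..m div 2}. square_sum z ^ k * v k z)"
      unfolding q_def sum_distrib_left by (intro sum.cong) (auto simp: mult.assoc[symmetric] power_add[symmetric])
    then show "u z = (\<Sum>k<p. square_sum z ^ k * v k z) + square_sum z ^ p * q z"
      unfolding u * by (subst sum.union_disjoint) auto
  qed
  show "canonical_proj p m u = (\<lambda>z. \<Sum>k<p. square_sum z ^ k * v k z)"
    by (rule canonical_proj_eqI[OF h m q eq])
qed

section \<open>Derivatives of the fundamental solution and the harmonic expansion\<close>

text \<open>A way to reason about iterated partial derivatives that is independent of the order in which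
\<open>multi_deriv\<close> applies them: \<open>K j\<close> is a class of functions reached after \<open>j\<close> differentiations.\<close>

lemma multi_deriv_induct:
  assumes "f \<in> K 0" and step: "\<And>j g i. g \<in> K j \<Longrightarrow> partial i g \<in> K (Suc j)"
  shows "multi_deriv \<alpha> f \<in> K (\<Sum>i\<in>UNIV. \<alpha> i)"
proof -
  have pow: "(partial i ^^ k) g \<in> K (k + j)" if "g \<in> K j" for i k g j
    using that by (induction k) (auto intro: step)
  have foldr: "foldr (\<lambda>i. partial i ^^ \<alpha> i) xs f \<in> K (\<Sum>i\<leftarrow>xs. \<alpha> i)" for xs
    by (induction xs) (auto intro: pow assms(1))
  have "\<exists>xs :: 'a list. distinct xs \<and> set xs = UNIV"
    using finite_distinct_list[of "UNIV :: 'a set"] by auto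
  then have "distinct (coord_list :: 'a list) \<and> set (coord_list :: 'a list) = UNIV"
    unfolding coord_list_def by (rule someI_ex)
  then have "(\<Sum>i\<leftarrow>coord_list. \<alpha> i) = (\<Sum>i\<in>UNIV. \<alpha> i)"
    by (metis sum_list_distinct_conv_sum_set)
  then show ?thesis using foldr[of coord_list] unfolding multi_deriv_def by simp
qed

lemma partial_eqI:
  "((\<lambda>t. f (x + t *\<^sub>R axis i 1)) has_vector_derivative D) (at 0) \<Longrightarrow> partial i f x = D"
  unfolding partial_def by (rule vector_derivative_at)

lemma partial_real_hom_polys: "u \<in> real_hom_polys m \<Longrightarrow> partial i u \<in> real_hom_polys (m - 1)"
proof -
  assume "u \<in> real_hom_polys m"
  then obtain f where f: "f \<in> hom_polys m" "u = f \<circ> cvec" by (auto simp: real_hom_polys_eq_image)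
  then have "partial i u = cpartial i f \<circ> cvec"
    by (auto intro!: partial_eqI real_line_derivative simp: fun_eq_iff)
  then show ?thesis using cpartial_hom[OF f(1)] by (auto simp: real_hom_polys_eq_image)
qed

lemma multi_deriv_real_hom_polys:
  "u \<in> real_hom_polys m \<Longrightarrow> multi_deriv \<alpha> u \<in> real_hom_polys (m - (\<Sum>i\<in>UNIV. \<alpha> i))"
  by (rule multi_deriv_induct[where K="\<lambda>j. real_hom_polys (m - j)"])
    (auto dest: partial_real_hom_polys)

lemma assoc_poly_hom:
  assumes "u \<in> real_hom_polys m" shows "assoc_poly d u k \<in> real_hom_polys (m - 2 * k)"
proof (cases "k = 0")
  case False
  have "\<exists>f\<in>hom_polys (m - 2 * k). multi_deriv (\<lambda>i. 2 * \<kappa> i) u = f \<circ> cvec" if "\<kappa> \<in> multi_indices k" for \<kappa>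
    using multi_deriv_real_hom_polys[OF assms, of "\<lambda>i. 2 * \<kappa> i"] that
    by (auto simp: real_hom_polys_eq_image multi_indices_def sum_distrib_left[symmetric])
  then obtain F where F: "\<And>\<kappa>. \<kappa> \<in> multi_indices k \<Longrightarrow> F \<kappa> \<in> hom_polys (m - 2 * k)"
    "\<And>\<kappa>. \<kappa> \<in> multi_indices k \<Longrightarrow> multi_deriv (\<lambda>i. 2 * \<kappa> i) u = F \<kappa> \<circ> cvec" by metis
  have "assoc_poly d u k = (\<lambda>z. \<Sum>\<kappa>\<in>multi_indices k. d k \<kappa> * F \<kappa> z) \<circ> cvec"
    using False by (simp add: assoc_poly_def F(2) fun_eq_iff)
  moreover have "(\<lambda>z. \<Sum>\<kappa>\<in>multi_indices k. d k \<kappa> * F \<kappa> z) \<in> hom_polys (m - 2 * k)"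
    by (intro hom_polys_sum hom_polys_scale F(1))
  ultimately show ?thesis by (auto simp: real_hom_polys_eq_image)
qed (simp add: assoc_poly_def assms)

text \<open>The functions that agree off the origin with the Kelvin transform of a harmonic homogeneous polynomial of
degree \<open>j\<close>. Nothing is required at the origin, where the fundamental solution and its derivatives have
no meaningful value.\<close>

definition kelvin_harmonics :: "nat \<Rightarrow> (real^'n::finite \<Rightarrow> complex) set" where
  "kelvin_harmonics j = {g. \<exists>p\<in>hom_polys j. claplacian p = (\<lambda>z. 0) \<and>
     (\<forall>x. x \<noteq> 0 \<longrightarrow> g x = of_real (norm x powi (2 - int CARD('n) - 2 * int j)) * p (cvec x))}"

text \<open>The derivatives below concern functions with a known form only off the origin, and \<open>partial\<close> depends only on the
values near the point.\<close>

lemma partial_local: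
  fixes f g :: "real^'n::finite \<Rightarrow> complex"
  assumes "\<And>y. y \<noteq> 0 \<Longrightarrow> g y = f y" "x \<noteq> 0"
    and "((\<lambda>t. f (x + t *\<^sub>R axis i 1)) has_vector_derivative D) (at 0)"
  shows "partial i g x = D"
proof (rule partial_eqI)
  define S where "S = (\<lambda>t::real. x + t *\<^sub>R axis i 1) -` (- {0})"
  have "open S" "0 \<in> S"
    unfolding S_def by (intro open_vimage continuous_intros) (use assms(2) in auto)
  moreover have "f (x + t *\<^sub>R axis i 1) = g (x + t *\<^sub>R axis i 1)" if "t \<in> S" for t
    using assms(1)[of "x + t *\<^sub>R axis i 1"] that by (simp add: S_def)
  ultimately show "((\<lambda>t. g (x + t *\<^sub>R axis i 1)) has_vector_derivative D) (at 0)"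
    by (rule has_vector_derivative_transform_within_open[OF assms(3)])
qed

lemma norm_line_derivative:
  fixes x :: "real^'n::finite"
  assumes "x \<noteq> 0"
  shows "((\<lambda>t. norm (x + t *\<^sub>R axis i 1)) has_real_derivative x $ i / norm x) (at 0)"
proof -
  have "(norm has_derivative (\<lambda>h. sgn x \<bullet> h)) (at (x + 0 *\<^sub>R axis i 1))"
    using has_derivative_norm[OF assms] by (simp add: inner_commute)
  then have "((\<lambda>t. norm (x + t *\<^sub>R axis i 1)) has_derivative (\<lambda>t. sgn x \<bullet> (t *\<^sub>R axis i 1))) (at 0)"
    by (rule has_derivative_compose[rotated]) (auto intro!: derivative_eq_intros)
  moreover have "(\<lambda>t. sgn x \<bullet> (t *\<^sub>R axis i 1)) = (*) (x $ i / norm x)"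
    by (auto simp: fun_eq_iff sgn_div_norm inner_axis divide_simps)
  ultimately show ?thesis by (simp add: has_field_derivative_def)
qed

text \<open>For \<open>g = |x|\<^sup>k p\<close> with \<open>k = 2 - n - 2j\<close> the derivative is \<open>\<partial>\<^sub>i g = |x|\<^bsup>k-2\<^esup> (k x\<^sub>i p + |x|\<^sup>2 \<partial>\<^sub>i p)\<close>. The Laplacian of
the polynomial in parentheses is \<open>(2k + 4(j-1) + 2n) \<partial>\<^sub>i p\<close>, and this factor is zero exactly for the given
exponent \<open>k\<close>.\<close>

lemma kelvin_harmonics_partial:
  fixes g :: "real^'n::finite \<Rightarrow> complex"
  assumes "g \<in> kelvin_harmonics j" shows "partial i g \<in> kelvin_harmonics (Suc j)"
proof -
  define k where "k = 2 - int CARD('n) - 2 * int j"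
  obtain p where p: "p \<in> hom_polys j" "claplacian p = (\<lambda>z. 0)"
    and g: "\<And>x. x \<noteq> 0 \<Longrightarrow> g x = of_real (norm x powi k) * p (cvec x)"
    using assms unfolding kelvin_harmonics_def k_def by auto
  define p' where "p' = (\<lambda>z. of_int k * (z $ i * p z) + square_sum z * cpartial i p z)"
  have sq: "(\<lambda>z. square_sum z * cpartial i p z) \<in> hom_polys (Suc j)"
  proof (cases j)
    case 0
    then show ?thesis using hom_polys_0D[of p] p(1) by (auto simp: hom_polys_zero)
  next
    case (Suc l)
    then show ?thesis using square_sum_power_mult_hom[OF cpartial_hom[OF p(1)], of 1 "Suc j" i] by simp
  qed
  have var: "(\<lambda>z. z $ i * p z) \<in> hom_polys (Suc j)" by (rule hom_polys_var[OF p(1)])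
  have p'_hom: "p' \<in> hom_polys (Suc j)"
    unfolding p'_def by (intro hom_polys_add hom_polys_scale var sq)
  have lap_var: "claplacian (\<lambda>z. z $ i * p z) z = 2 * cpartial i p z" for z
    unfolding claplacian_mult[OF coordinate_hom p(1)] p(2)
    by (simp add: cpartial_coordinate claplacian_def if_distrib[of "\<lambda>t. t * _"] cong: if_cong)
  have lap_sq: "claplacian (\<lambda>z. square_sum z * cpartial i p z) z
      = of_int (4 * (int j - 1) + 2 * int CARD('n)) * cpartial i p z" for z
  proof (cases j)
    case 0
    then show ?thesis using hom_polys_0D[of p] p(1) by auto
  next
    case (Suc l)
    have "claplacian (cpartial i p) = (\<lambda>z. 0)"
      using claplacian_cpartial[OF p(1), of i] p(2) by simp
    then show ?thesis
      using fun_cong[OF claplacian_square_sum_mult[OF cpartial_hom[OF p(1)], of i], of z] Suc by simp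
  qed
  have "claplacian p' = (\<lambda>z. 0)"
  proof
    fix z
    have "claplacian p' z = of_int k * (2 * cpartial i p z)
        + of_int (4 * (int j - 1) + 2 * int CARD('n)) * cpartial i p z"
      unfolding p'_def claplacian_add[OF hom_polys_scale[OF var] sq] claplacian_scale[OF var] lap_var lap_sq ..
    also have "\<dots> = of_int (k * 2 + (4 * (int j - 1) + 2 * int CARD('n))) * cpartial i p z"
      by (simp add: algebra_simps)
    also have "k * 2 + (4 * (int j - 1) + 2 * int CARD('n)) = 0"
      unfolding k_def by simp
    finally show "claplacian p' z = 0" by simp
  qed
  moreover have "partial i g x = of_real (norm x powi (2 - int CARD('n) - 2 * int (Suc j))) * p' (cvec x)"
    if x: "x \<noteq> 0" for x
  proof -
    have n: "norm x \<noteq> 0" using x by simp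
    have "((\<lambda>t. norm (x + t *\<^sub>R axis i 1) powi k) has_real_derivative
        of_int k * norm x powi (k - 1) * (x $ i / norm x)) (at 0)"
      using n by (auto intro!: derivative_eq_intros norm_line_derivative[OF x])
    then have "((\<lambda>t. complex_of_real (norm (x + t *\<^sub>R axis i 1) powi k)) has_vector_derivative
        of_real (of_int k * norm x powi (k - 1) * (x $ i / norm x))) (at 0)"
      by (rule has_vector_derivative_of_real)
    note has_vector_derivative_mult[OF this real_line_derivative[OF p(1), of x i]]
    then have "((\<lambda>t. of_real (norm (x + t *\<^sub>R axis i 1) powi k) * p (cvec (x + t *\<^sub>R axis i 1))) has_vector_derivative
        of_real (norm x powi k) * cpartial i p (cvec x)
        + of_real (of_int k * norm x powi (k - 1) * (x $ i / norm x)) * p (cvec x)) (at 0)"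
      by simp
    from partial_local[where f="\<lambda>x. of_real (norm x powi k) * p (cvec x)", OF g x this]
    have "partial i g x = of_real (norm x powi k) * cpartial i p (cvec x)
        + of_real (of_int k * norm x powi (k - 1) * (x $ i / norm x)) * p (cvec x)" .
    moreover define r where "r = norm x powi (k - 2)"
    moreover have "of_int k * norm x powi (k - 1) * (x $ i / norm x) = of_int k * (r * x $ i)"
      "norm x powi k = r * (norm x)\<^sup>2"
      unfolding r_def using n by (simp_all add: power_int_diff power2_eq_square)
    ultimately have "partial i g x = of_real (r * (norm x)\<^sup>2) * cpartial i p (cvec x)
        + of_real (of_int k * (r * x $ i)) * p (cvec x)" by (simp only:)
    also have "\<dots> = of_real r * p' (cvec x)"
      unfolding p'_def square_sum_cvec by (simp add: cvec_def algebra_simps)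
    finally show ?thesis unfolding r_def k_def by (simp add: algebra_simps)
  qed
  ultimately show ?thesis unfolding kelvin_harmonics_def using p'_hom by auto
qed

lemma norm_power_kelvin_harmonics: "norm_power \<in> kelvin_harmonics 0"
  unfolding kelvin_harmonics_def norm_power_def by (auto intro!: bexI[of _ "\<lambda>z. 1"] hom_polys_const)

lemma multi_deriv_norm_power: "multi_deriv \<alpha> norm_power \<in> kelvin_harmonics (\<Sum>i\<in>UNIV. \<alpha> i)"
  by (rule multi_deriv_induct[OF norm_power_kelvin_harmonics kelvin_harmonics_partial])

lemma partial_log_norm:
  assumes "CARD('n::finite) = 2"
  shows "partial i (log_norm :: real^'n \<Rightarrow> complex) \<in> kelvin_harmonics (Suc 0)"
proof -
  have "(\<lambda>z. z $ i * 1) \<in> (hom_polys (Suc 0) :: (complex^'n \<Rightarrow> complex) set)"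
    by (rule hom_polys_var[OF hom_polys_const])
  moreover have "claplacian (\<lambda>z::complex^'n. z $ i) = (\<lambda>z. 0)"
    using claplacian_low_degree[OF coordinate_hom] by simp
  moreover have "partial i log_norm x = of_real (norm x powi - 2) * cvec x $ i" if x: "x \<noteq> 0" for x :: "real^'n"
  proof (rule partial_eqI)
    have "((\<lambda>t. ln (norm (x + t *\<^sub>R axis i 1))) has_real_derivative (x $ i / norm x) / norm x) (at 0)"
      using x by (auto intro!: derivative_eq_intros norm_line_derivative[OF x])
    then have "((\<lambda>t. log_norm (x + t *\<^sub>R axis i 1)) has_vector_derivative of_real ((x $ i / norm x) / norm x)) (at 0)"
      unfolding log_norm_def by (rule has_vector_derivative_of_real)
    then show "((\<lambda>t. log_norm (x + t *\<^sub>R axis i 1)) has_vector_derivative of_real (norm x powi - 2) * cvec x $ i) (at 0)"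
      by (simp add: cvec_def power_int_minus field_simps power2_eq_square)
  qed
  ultimately show ?thesis unfolding kelvin_harmonics_def using assms by auto
qed

text \<open>The logarithm itself is not in any of the classes, but its first derivatives are in the one of degree 1, so
only the first step of the induction needs separate treatment.\<close>

lemma multi_deriv_log_norm:
  fixes \<alpha> :: "'n::finite \<Rightarrow> nat"
  assumes "CARD('n) = 2" "(\<Sum>i\<in>UNIV. \<alpha> i) \<noteq> 0"
  shows "multi_deriv \<alpha> (log_norm :: real^'n \<Rightarrow> complex) \<in> kelvin_harmonics (\<Sum>i\<in>UNIV. \<alpha> i)"
proof -
  have "multi_deriv \<alpha> (log_norm :: real^'n \<Rightarrow> complex)
      \<in> (\<lambda>j. if j = 0 then {log_norm} else kelvin_harmonics j) (\<Sum>i\<in>UNIV. \<alpha> i)"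
    by (rule multi_deriv_induct)
      (auto intro: kelvin_harmonics_partial partial_log_norm[OF assms(1)] split: if_splits)
  then show ?thesis using assms(2) by simp
qed

lemma kelvin_harmonics_sum:
  assumes "\<And>\<alpha>. \<alpha> \<in> A \<Longrightarrow> g \<alpha> \<in> kelvin_harmonics j"
  shows "(\<lambda>x. \<Sum>\<alpha>\<in>A. a \<alpha> * g \<alpha> x) \<in> kelvin_harmonics j"
proof -
  obtain p where p: "\<And>\<alpha>. \<alpha> \<in> A \<Longrightarrow> p \<alpha> \<in> hom_polys j" "\<And>\<alpha>. \<alpha> \<in> A \<Longrightarrow> claplacian (p \<alpha>) = (\<lambda>z. 0)"
    "\<And>\<alpha> x. \<alpha> \<in> A \<Longrightarrow> x \<noteq> 0 \<Longrightarrow> g \<alpha> x = of_real (norm x powi (2 - int CARD('b) - 2 * int j)) * p \<alpha> (cvec x)"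
    using assms unfolding kelvin_harmonics_def by simp metis
  have "(\<lambda>z. \<Sum>\<alpha>\<in>A. a \<alpha> * p \<alpha> z) \<in> hom_polys j \<and> claplacian (\<lambda>z. \<Sum>\<alpha>\<in>A. a \<alpha> * p \<alpha> z) = (\<lambda>z. 0)"
    using p(1,2)
  proof (induction A rule: infinite_finite_induct)
    case (insert \<alpha> A)
    then have "p \<alpha> \<in> hom_polys j" "claplacian (p \<alpha>) = (\<lambda>z. 0)"
      "(\<lambda>z. \<Sum>\<alpha>\<in>A. a \<alpha> * p \<alpha> z) \<in> hom_polys j" "claplacian (\<lambda>z. \<Sum>\<alpha>\<in>A. a \<alpha> * p \<alpha> z) = (\<lambda>z. 0)"
      by auto
    then show ?case using insert(1,2)
      by (simp add: claplacian_add[OF hom_polys_scale] claplacian_scale hom_polys_add hom_polys_scale)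
  qed (auto simp: hom_polys_zero)
  moreover have "(\<Sum>\<alpha>\<in>A. a \<alpha> * g \<alpha> x) = of_real (norm x powi (2 - int CARD('b) - 2 * int j)) * (\<Sum>\<alpha>\<in>A. a \<alpha> * p \<alpha> (cvec x))"
    if "x \<noteq> 0" for x
    unfolding sum_distrib_left using that by (intro sum.cong) (simp_all add: p(3))
  ultimately show ?thesis unfolding kelvin_harmonics_def by auto
qed

lemma poly_diff_op_kelvin_harmonics:
  fixes w f :: "real^'n::finite \<Rightarrow> complex"
  assumes "w \<in> real_hom_polys j"
    and "\<And>\<alpha>. \<alpha> \<in> multi_indices j \<Longrightarrow> multi_deriv \<alpha> f \<in> kelvin_harmonics j"
  shows "poly_diff_op w f \<in> kelvin_harmonics j"
proof -
  obtain a where w: "w = (\<lambda>x. \<Sum>\<alpha>\<in>multi_indices j. a \<alpha> * of_real (multi_power x \<alpha>))"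
    using assms(1) by (auto simp: real_hom_polys_def)
  show ?thesis
    unfolding w poly_diff_op_eq[abs_def] by (intro kelvin_harmonics_sum assms(2))
qed

text \<open>The Kelvin transform is an involution, and on the unit sphere it is the identity.\<close>

lemma kelvin_kelvin_harmonics:
  fixes g :: "real^'n::finite \<Rightarrow> complex"
  assumes "g \<in> kelvin_harmonics j"
  obtains p where "p \<in> hom_polys j" "claplacian p = (\<lambda>z. 0)"
    "\<And>x. x \<noteq> 0 \<Longrightarrow> kelvin g x = p (cvec x)" "\<And>x. norm x = 1 \<Longrightarrow> g x = p (cvec x)"
proof -
  define k where "k = 2 - int CARD('n) - 2 * int j"
  obtain p where p: "p \<in> hom_polys j" "claplacian p = (\<lambda>z. 0)"
    and g: "\<And>x. x \<noteq> 0 \<Longrightarrow> g x = of_real (norm x powi k) * p (cvec x)"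
    using assms unfolding kelvin_harmonics_def k_def by auto
  have "kelvin g x = p (cvec x)" if x: "x \<noteq> 0" for x
  proof -
    define r where "r = norm x"
    have r: "r \<noteq> 0" using x by (simp add: r_def)
    have "norm (x /\<^sub>R r\<^sup>2) = inverse r"
      using r unfolding norm_scaleR r_def[symmetric] by (simp add: power2_eq_square)
    then have "kelvin g x = of_real (r powi (2 - int CARD('n)))
        * (of_real (inverse r powi k) * (of_real (inverse (r\<^sup>2)) ^ j * p (cvec x)))"
      unfolding kelvin_def norm_power_def r_def[symmetric]
      using r x by (subst g) (simp_all add: cvec_scaleR hom_polys_homogeneous[OF p(1)])
    also have "\<dots> = of_real (r powi (2 - int CARD('n)) * (inverse r powi k * inverse (r\<^sup>2) ^ j)) * p (cvec x)"
      unfolding of_real_mult of_real_power by (simp only: mult.assoc)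
    also have "r powi (2 - int CARD('n)) * (inverse r powi k * inverse (r\<^sup>2) ^ j) = 1"
    proof -
      have "r powi (k + int (2 * j)) = r powi k * r powi int (2 * j)"
        by (rule power_int_add) (simp add: r)
      moreover have "k + int (2 * j) = 2 - int CARD('n)" unfolding k_def by simp
      ultimately have "r powi (2 - int CARD('n)) = r powi k * r ^ (2 * j)"
        unfolding power_int_of_nat by simp
      moreover have "inverse r powi k = inverse (r powi k)" "inverse (r\<^sup>2) ^ j = inverse (r ^ (2 * j))"
        by (simp_all only: power_int_inverse power_inverse power_mult)
      moreover have "A * B * (inverse A * inverse B) = 1" if "A \<noteq> 0" "B \<noteq> 0" for A B :: real
        using that by (simp add: field_simps)
      ultimately show ?thesis using r by simp
    qed
    finally show ?thesis by simp
  qed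
  moreover have "g x = p (cvec x)" if "norm x = 1" for x using g[of x] that by fastforce
  ultimately show ?thesis using that p by blast
qed

text \<open>The term \<open>v\<^sub>k\<close> is the Kelvin transform from the defining property of the constants, divided by its
constant. In the plane the term with \<open>2 * k = m\<close> is instead the constant polynomial \<open>u\<^sub>k\<close> itself, because the
undifferentiated logarithm has no Kelvin form; restricting the last two conclusions to \<open>2 * k < m\<close> avoids this term.\<close>

lemma harmonic_expansion:
  fixes d :: "nat \<Rightarrow> ('n::finite \<Rightarrow> nat) \<Rightarrow> complex" and u :: "complex^'n \<Rightarrow> complex"
  assumes n: "CARD('n) \<ge> 2" and d: "kelvin_constants m d" and u: "u \<in> hom_polys m"
  obtains v where "\<And>k. 2 * k \<le> m \<Longrightarrow> v k \<in> hom_polys (m - 2 * k)"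
    "\<And>k. 2 * k < m \<Longrightarrow> claplacian (v k) = (\<lambda>z. 0)"
    "u = (\<lambda>z. \<Sum>k\<le>m div 2. square_sum z ^ k * v k z)"
    "\<And>k x. 2 * k < m \<Longrightarrow> norm x = 1 \<Longrightarrow> CARD('n) > 2 \<Longrightarrow>
       poly_diff_op (assoc_poly d (u \<circ> cvec) k) norm_power x / of_real (kelvin_c CARD('n) (m - 2 * k)) = v k (cvec x)"
    "\<And>k x. 2 * k < m \<Longrightarrow> norm x = 1 \<Longrightarrow> CARD('n) = 2 \<Longrightarrow>
       poly_diff_op (assoc_poly d (u \<circ> cvec) k) log_norm x / of_real (kelvin_c2 (m - 2 * k)) = v k (cvec x)"
proof -
  let ?w = "assoc_poly d (u \<circ> cvec)"
  have w: "?w k \<in> real_hom_polys (m - 2 * k)" for k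
    by (rule assoc_poly_hom) (use u in \<open>auto simp: real_hom_polys_eq_image\<close>)
  define L :: "real^'n \<Rightarrow> complex" where "L = (if CARD('n) = 2 then log_norm else norm_power)"
  define c where "c j = (if CARD('n) = 2 then kelvin_c2 j else kelvin_c CARD('n) j)" for j
  have cls: "poly_diff_op (?w k) L \<in> kelvin_harmonics (m - 2 * k)" if "2 * k < m \<or> CARD('n) \<noteq> 2" for k
  proof (rule poly_diff_op_kelvin_harmonics[OF w])
    fix \<alpha> :: "'n \<Rightarrow> nat" assume "\<alpha> \<in> multi_indices (m - 2 * k)"
    then have "(\<Sum>i\<in>UNIV. \<alpha> i) = m - 2 * k" by (simp add: multi_indices_def)
    then show "multi_deriv \<alpha> L \<in> kelvin_harmonics (m - 2 * k)"
      using that multi_deriv_log_norm[of \<alpha>] multi_deriv_norm_power[of \<alpha>] unfolding L_def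
      by (cases "CARD('n) = 2") simp_all
  qed
  define P where "P k v \<longleftrightarrow> v \<in> hom_polys (m - 2 * k) \<and> (2 * k < m \<longrightarrow> claplacian v = (\<lambda>z. 0)) \<and>
      (\<forall>x. x \<noteq> 0 \<longrightarrow> (if 2 * k = m \<and> CARD('n) = 2 then ?w k x
          else kelvin (poly_diff_op (?w k) L) x / of_real (c (m - 2 * k))) = v (cvec x)) \<and>
      (\<forall>x. 2 * k < m \<longrightarrow> norm x = 1 \<longrightarrow> poly_diff_op (?w k) L x / of_real (c (m - 2 * k)) = v (cvec x))"
    for k and v :: "complex^'n \<Rightarrow> complex"
  have "\<exists>v. P k v" if "2 * k \<le> m" for k
  proof (cases "2 * k = m \<and> CARD('n) = 2")
    case True
    then show ?thesis using w[of k] by (auto simp: real_hom_polys_eq_image P_def)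
  next
    case False
    then have "2 * k < m \<or> CARD('n) \<noteq> 2" using that by auto
    from kelvin_kelvin_harmonics[OF cls[OF this]] obtain p where p: "p \<in> hom_polys (m - 2 * k)"
      "claplacian p = (\<lambda>z. 0)" "\<And>x. x \<noteq> 0 \<Longrightarrow> kelvin (poly_diff_op (?w k) L) x = p (cvec x)"
      "\<And>x. norm x = 1 \<Longrightarrow> poly_diff_op (?w k) L x = p (cvec x)" by blast
    have "claplacian (\<lambda>z. (1 / of_real (c (m - 2 * k))) * p z) = (\<lambda>z. 0)"
      unfolding claplacian_scale[OF p(1)] p(2) by simp
    then have "P k (\<lambda>z. (1 / of_real (c (m - 2 * k))) * p z)"
      unfolding P_def
      using p(3,4) False hom_polys_scale[OF p(1), of "1 / of_real (c (m - 2 * k))"] by auto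
    then show ?thesis by (rule exI[where P="P k"])
  qed
  then have "\<forall>k\<in>{k. 2 * k \<le> m}. \<exists>v. P k v" by blast
  from bchoice[OF this] obtain v where v: "\<And>k. 2 * k \<le> m \<Longrightarrow> P k (v k)" by blast
  note v = v[unfolded P_def, THEN conjunct1] v[OF less_imp_le, unfolded P_def, THEN conjunct2, THEN conjunct1, THEN mp]
    v[unfolded P_def, THEN conjunct2, THEN conjunct2, THEN conjunct1, rule_format]
    v[OF less_imp_le, unfolded P_def, THEN conjunct2, THEN conjunct2, THEN conjunct2, rule_format]
  have u_eq: "u = (\<lambda>z. \<Sum>k\<le>m div 2. square_sum z ^ k * v k z)"
  proof (rule hom_polys_eq_on_sphere[OF u])
    show "(\<lambda>z. \<Sum>k\<le>m div 2. square_sum z ^ k * v k z) \<in> hom_polys m"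
      by (intro hom_polys_sum square_sum_power_mult_hom[OF v(1)]) auto
    fix x :: "real^'n" assume x: "norm x = 1"
    then have x0: "x \<noteq> 0" by auto
    have uR: "u \<circ> cvec \<in> real_hom_polys m" using u by (auto simp: real_hom_polys_eq_image)
    have "u (cvec x) = (\<Sum>k\<le>m div 2. if 2 * k = m \<and> CARD('n) = 2 then ?w k x
          else kelvin (poly_diff_op (?w k) L) x / of_real (c (m - 2 * k)))"
    proof (cases "CARD('n) = 2")
      case True
      then have "(u \<circ> cvec) x = (\<Sum>k\<le>m div 2. if 2 * k = m then of_real (norm x ^ m) * ?w k x
                    else of_real (norm x ^ (2 * k) / kelvin_c2 (m - 2 * k)) * kelvin (poly_diff_op (?w k) log_norm) x)"
        using d uR x0 unfolding kelvin_constants_def by blast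
      then show ?thesis using True x by (simp add: L_def c_def o_def cong: if_cong)
    next
      case False
      then have "CARD('n) > 2" using n by simp
      then have "(u \<circ> cvec) x = (\<Sum>k\<le>m div 2. of_real (norm x ^ (2 * k) / kelvin_c CARD('n) (m - 2 * k))
                     * kelvin (poly_diff_op (?w k) norm_power) x)"
        using d uR x0 unfolding kelvin_constants_def by blast
      then show ?thesis using False x by (simp add: L_def c_def o_def)
    qed
    also have "\<dots> = (\<Sum>k\<le>m div 2. square_sum (cvec x) ^ k * v k (cvec x))"
    proof (rule sum.cong[OF refl])
      fix k assume "k \<in> {..m div 2}"
      then have "2 * k \<le> m" by auto
      from v(3)[OF this x0] show "(if 2 * k = m \<and> CARD('n) = 2 then ?w k x
          else kelvin (poly_diff_op (?w k) L) x / of_real (c (m - 2 * k))) = square_sum (cvec x) ^ k * v k (cvec x)"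
        by (simp only: square_sum_cvec x) simp
    qed
    finally show "u (cvec x) = (\<Sum>k\<le>m div 2. square_sum (cvec x) ^ k * v k (cvec x))" .
  qed
  show ?thesis
  proof (rule that[OF v(1) v(2) u_eq])
    fix k and x :: "real^'n" assume "2 * k < m" "norm x = 1"
    note v(4)[OF this(1) this]
    then show "CARD('n) > 2 \<Longrightarrow>
        poly_diff_op (?w k) norm_power x / of_real (kelvin_c CARD('n) (m - 2 * k)) = v k (cvec x)"
      "CARD('n) = 2 \<Longrightarrow>
        poly_diff_op (?w k) log_norm x / of_real (kelvin_c2 (m - 2 * k)) = v k (cvec x)"
      by (simp_all add: L_def c_def)
  qed
qed

section \<open>Rotation invariance of the surface measure\<close>

text \<open>Both sides are translation-invariant measures that give the unit ball the same mass. Following the usual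
uniqueness proof for such measures, the double integral of \<open>indicator A (R x + y) * indicator B y\<close>, with \<open>B\<close> the unit ball, is
computed in both orders of integration: one order gives the measure of \<open>R -` A\<close>, the other that of \<open>A\<close>, each times the volume
of \<open>B\<close>.\<close>

lemma lborel_distr_isometry:
  fixes R :: "'a::euclidean_space \<Rightarrow> 'a"
  assumes "linear R" "\<And>x. norm (R x) = norm x" "surj R"
  shows "distr lborel borel R = lborel"
proof (rule measure_eqI)
  interpret linear R by fact
  have R_meas [measurable]: "R \<in> borel_measurable borel"
    using assms(1) by (intro borel_measurable_continuous_onI linear_continuous_on linear_linear[THEN iffD2])
  fix A :: "'a set" assume "A \<in> sets (distr lborel borel R)"
  then have A [measurable]: "A \<in> sets borel" by simp
  define B :: "'a set" where "B = ball 0 1"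
  have B [measurable]: "B \<in> sets borel" by (simp add: B_def)
  have shift: "(\<integral>\<^sup>+x. f (c + x) \<partial>lborel) = (\<integral>\<^sup>+x. f x \<partial>lborel)" if [measurable]: "f \<in> borel_measurable borel" for f and c :: 'a
    by (subst (2) lborel_distr_plus[of c, symmetric]) (simp add: nn_integral_distr)
  have b: "(\<integral>\<^sup>+x. indicator B (y - R x) \<partial>lborel) = emeasure lborel B" for y
  proof -
    obtain v where v: "y = R v" using assms(3) by blast
    have "indicator B (y - R (v + x)) = (indicator B x :: ennreal)" for x
      unfolding v add B_def by (simp add: indicator_def assms(2))
    then have "(\<integral>\<^sup>+x. indicator B (y - R (v + x)) \<partial>lborel) = emeasure lborel B"
      using nn_integral_indicator[of B lborel] by simp
    then show ?thesis using shift[of "\<lambda>x. indicator B (y - R x)" v] by simp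
  qed
  have "emeasure lborel (R -` A) * emeasure lborel B = (\<integral>\<^sup>+y. indicator B y * emeasure lborel (R -` A) \<partial>lborel)"
    by (subst nn_integral_multc) (simp_all add: mult.commute)
  also have "\<dots> = (\<integral>\<^sup>+y. (\<integral>\<^sup>+x. indicator A (R x + y) * indicator B y \<partial>lborel) \<partial>lborel)"
  proof (rule nn_integral_cong)
    fix y
    obtain v where v: "y = R v" using assms(3) by blast
    have "emeasure lborel (R -` A) = (\<integral>\<^sup>+x. indicator A (R x) \<partial>lborel)"
      using nn_integral_indicator[of "R -` A" lborel] measurable_sets[OF R_meas A]
      by (simp add: indicator_vimage)
    also have "\<dots> = (\<integral>\<^sup>+x. indicator A (R (v + x)) \<partial>lborel)"
      by (rule shift[symmetric]) measurable
    also have "\<dots> = (\<integral>\<^sup>+x. indicator A (R x + y) \<partial>lborel)" unfolding v by (simp add: add add.commute)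
    finally show "indicator B y * emeasure lborel (R -` A) = (\<integral>\<^sup>+x. indicator A (R x + y) * indicator B y \<partial>lborel)"
      by (subst nn_integral_multc) (simp_all add: mult.commute)
  qed
  also have "\<dots> = (\<integral>\<^sup>+x. (\<integral>\<^sup>+y. indicator A (R x + y) * indicator B y \<partial>lborel) \<partial>lborel)"
    by (rule lborel_pair.Fubini') measurable
  also have "\<dots> = (\<integral>\<^sup>+x. (\<integral>\<^sup>+y. indicator A y * indicator B (y - R x) \<partial>lborel) \<partial>lborel)"
  proof (rule nn_integral_cong)
    fix x
    show "(\<integral>\<^sup>+y. indicator A (R x + y) * indicator B y \<partial>lborel) = (\<integral>\<^sup>+y. indicator A y * indicator B (y - R x) \<partial>lborel)"
      using shift[of "\<lambda>y. indicator A y * indicator B (y - R x)" "R x"] by simp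
  qed
  also have "\<dots> = (\<integral>\<^sup>+y. (\<integral>\<^sup>+x. indicator A y * indicator B (y - R x) \<partial>lborel) \<partial>lborel)"
    by (rule lborel_pair.Fubini'[symmetric]) measurable
  also have "\<dots> = (\<integral>\<^sup>+y. indicator A y * emeasure lborel B \<partial>lborel)"
    by (subst nn_integral_cmult) (simp_all add: b)
  also have "\<dots> = emeasure lborel A * emeasure lborel B"
    by (subst nn_integral_multc) simp_all
  finally have "emeasure lborel (R -` A) * emeasure lborel B = emeasure lborel A * emeasure lborel B" .
  moreover have "emeasure lborel B \<noteq> 0" "emeasure lborel B \<noteq> \<infinity>"
    using emeasure_lborel_ball_finite[of "0::'a" 1] content_ball_pos[of 1 "0::'a"]
    unfolding B_def by (auto simp: measure_def)
  ultimately have "emeasure lborel (R -` A) = emeasure lborel A"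
    by (metis ennreal_mult_cancel_left infinity_ennreal_def mult.commute)
  then show "emeasure (distr lborel borel R) A = emeasure lborel A"
    by (simp add: emeasure_distr)
qed simp

lemma sets_surface_measure [simp]: "sets (surface_measure :: (real^'n::finite) measure) = sets (restrict_space borel (sphere 0 1))"
  by (simp add: surface_measure_def)

lemma space_surface_measure [simp]: "space (surface_measure :: (real^'n::finite) measure) = sphere 0 1"
  by (simp add: surface_measure_def space_restrict_space)

lemma emeasure_surface_measure:
  assumes "A \<in> sets (restrict_space borel (sphere 0 1 :: (real^'n::finite) set))"
  shows "emeasure surface_measure A =
    emeasure lborel (ball 0 1 \<inter> (sgn -` A - {0})) / emeasure lborel (ball 0 1 :: (real^'n) set)"
proof -
  have sgn: "sgn \<in> borel_measurable (borel :: (real^'n) measure)"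
    unfolding sgn_div_norm[abs_def] by measurable
  have "A \<in> sets borel" using assms by (auto simp: sets_restrict_space)
  then have m: "sgn -` A - {0} \<in> sets (borel :: (real^'n) measure)"
    using measurable_sets[OF sgn] by simp
  have "emeasure surface_measure A =
      emeasure (restrict_space (uniform_measure lborel (ball 0 1)) (- {0})) (sgn -` A - {0 :: real^'n})"
    unfolding surface_measure_def
    by (subst emeasure_distr[OF sgn_measurable_sphere assms])
      (auto simp: space_restrict_space intro!: arg_cong[of _ _ "emeasure _"])
  also have "\<dots> = emeasure (uniform_measure lborel (ball 0 1)) (sgn -` A - {0 :: real^'n})"
    by (rule emeasure_restrict_space) auto
  also have "\<dots> = emeasure lborel (ball 0 1 \<inter> (sgn -` A - {0})) / emeasure lborel (ball 0 1 :: (real^'n) set)"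
    using m by simp
  finally show ?thesis .
qed

text \<open>The cone over the preimage of \<open>A\<close> is the preimage of the cone over \<open>A\<close>, since \<open>R\<close> commutes with \<open>sgn\<close>.\<close>

lemma surface_measure_isometry_invariant:
  fixes R :: "real^'n::finite \<Rightarrow> real^'n"
  assumes R: "linear R" "\<And>x. norm (R x) = norm x" "surj R"
  shows "distr surface_measure surface_measure R = surface_measure"
    and "R \<in> measurable surface_measure surface_measure"
proof -
  have R_borel: "R \<in> borel_measurable borel"
    using R(1) by (intro borel_measurable_continuous_onI linear_continuous_on linear_linear[THEN iffD2])
  have "R \<in> measurable (restrict_space borel (sphere 0 1)) (restrict_space borel (sphere 0 1))"
    by (rule measurable_restrict_space2) (auto simp: space_restrict_space R(2) intro: measurable_restrict_space1[OF R_borel])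
  then show meas: "R \<in> measurable surface_measure surface_measure"
    by (simp cong: measurable_cong_sets)
  show "distr surface_measure surface_measure R = surface_measure"
  proof (rule measure_eqI)
    fix A assume "A \<in> sets (distr surface_measure surface_measure R)"
    then have A: "A \<in> sets (surface_measure :: (real^'n) measure)" by simp
    let ?S = "\<lambda>A. ball 0 1 \<inter> (sgn -` A - {0 :: real^'n})"
    have RA: "R -` A \<inter> sphere 0 1 \<in> sets surface_measure"
      using measurable_sets[OF meas A] by simp
    have sgn: "sgn \<in> borel_measurable (borel :: (real^'n) measure)"
      unfolding sgn_div_norm[abs_def] by measurable
    have "A \<in> sets borel" using A by (auto simp: sets_restrict_space)
    then have SA: "?S A \<in> sets borel"
      using measurable_sets[OF sgn, of A] by simp
    have sgnR: "sgn (R x) = R (sgn x)" for x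
      using linear_scale[OF R(1)] by (simp add: sgn_div_norm R(2))
    have R0: "R x = 0 \<longleftrightarrow> x = 0" for x using R(2)[of x] by auto
    have "?S (R -` A \<inter> sphere 0 1) = R -` ?S A"
      by (auto simp: sgnR R0 R(2) norm_sgn)
    moreover have "emeasure lborel (R -` ?S A) = emeasure lborel (?S A)"
      using emeasure_distr[of R lborel borel "?S A"] R_borel SA lborel_distr_isometry[OF R] by simp
    ultimately have "emeasure surface_measure (R -` A \<inter> sphere 0 1) = emeasure surface_measure A"
      using RA A by (simp add: emeasure_surface_measure)
    then show "emeasure (distr surface_measure surface_measure R) A = emeasure surface_measure A"
      by (simp add: emeasure_distr[OF meas A])
  qed simp
qed

section \<open>Integrals of polynomials over the sphere\<close>

definition sphere_integral :: "(complex^'n::finite \<Rightarrow> complex) \<Rightarrow> complex" where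
  "sphere_integral f = (\<integral>\<zeta>. f (cvec \<zeta>) \<partial>surface_measure)"

lemma continuous_integrable_sphere:
  assumes "continuous_on UNIV (f :: real^'n::finite \<Rightarrow> complex)"
  shows "integrable surface_measure f"
proof -
  interpret prob_space "surface_measure :: (real^'n) measure" by (rule prob_space_surface_measure)
  have "bounded (f ` sphere 0 1)"
    by (intro compact_imp_bounded compact_continuous_image continuous_on_subset[OF assms]) auto
  then obtain B where "\<forall>x\<in>sphere 0 1. norm (f x) \<le> B" by (auto simp: bounded_iff)
  moreover have "f \<in> borel_measurable surface_measure"
    using measurable_restrict_space1[OF borel_measurable_continuous_onI[OF assms]]
    by (simp cong: measurable_cong_sets)
  ultimately show ?thesis by (intro integrable_const_bound[of _ B]) auto
qed

lemma hom_poly_continuous_real: "f \<in> hom_polys m \<Longrightarrow> continuous_on A (\<lambda>x. f (cvec x))"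
  by (rule continuous_on_compose2[OF hom_polys_continuous]) (auto intro!: continuous_cvec continuous_intros)

lemma hom_poly_integrable: "f \<in> hom_polys m \<Longrightarrow> integrable surface_measure (\<lambda>x. f (cvec x))"
  by (rule continuous_integrable_sphere[OF hom_poly_continuous_real])

lemma hom_poly_bounded_sphere:
  assumes "f \<in> hom_polys m"
  obtains B where "0 \<le> B" "\<And>x. norm x = 1 \<Longrightarrow> norm (f (cvec x)) \<le> B"
proof -
  have "bounded ((\<lambda>x. f (cvec x)) ` sphere 0 1)"
    by (intro compact_imp_bounded compact_continuous_image hom_poly_continuous_real[OF assms]) auto
  then obtain B where "\<forall>x\<in>sphere 0 1. norm (f (cvec x)) \<le> B" by (auto simp: bounded_iff)
  then show ?thesis using that[of "max B 0"] by (simp add: max.coboundedI1)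
qed

definition plane_rotation :: "'n \<Rightarrow> 'n \<Rightarrow> real \<Rightarrow> real^'n::finite \<Rightarrow> real^'n" where
  "plane_rotation i j t x = (\<chi> k. if k = i then cos t * x $ i - sin t * x $ j
     else if k = j then sin t * x $ i + cos t * x $ j else x $ k)"

lemma plane_rotation_linear: "linear (plane_rotation i j t)"
  by (rule linearI) (auto simp: plane_rotation_def vec_eq_iff algebra_simps)

lemma plane_rotation_norm:
  fixes x :: "real^'n::finite"
  assumes "i \<noteq> j" shows "norm (plane_rotation i j t x) = norm x"
proof -
  have split: "(\<Sum>k\<in>UNIV. (y $ k)\<^sup>2) = (y $ i)\<^sup>2 + (y $ j)\<^sup>2 + (\<Sum>k\<in>UNIV - {i, j}. (y $ k)\<^sup>2)" for y :: "real^'n"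
    using assms sum.subset_diff[of "{i, j}" UNIV "\<lambda>k. (y $ k)\<^sup>2"] by simp
  have "(c * a - s * b)\<^sup>2 + (s * a + c * b)\<^sup>2 = (s\<^sup>2 + c\<^sup>2) * (a\<^sup>2 + b\<^sup>2)" for a b c s :: real
    by (simp add: power2_eq_square algebra_simps)
  from this[of "cos t" "x $ i" "sin t" "x $ j"]
  have "(cos t * x $ i - sin t * x $ j)\<^sup>2 + (sin t * x $ i + cos t * x $ j)\<^sup>2 = (x $ i)\<^sup>2 + (x $ j)\<^sup>2"
    by simp
  then have "(\<Sum>k\<in>UNIV. (plane_rotation i j t x $ k)\<^sup>2) = (\<Sum>k\<in>UNIV. (x $ k)\<^sup>2)"
    unfolding split using assms by (simp add: plane_rotation_def)
  then show ?thesis by (simp add: norm_vec_def L2_set_def)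
qed

lemma plane_rotation_surj:
  assumes "i \<noteq> j" shows "surj (plane_rotation i j t)"
  using plane_rotation_linear plane_rotation_norm[OF assms]
  by (metis linear_injective_imp_surjective linear_injective_0 norm_eq_zero)

lemma sphere_integral_rotation:
  assumes "i \<noteq> j" "f \<in> hom_polys m"
  shows "(\<integral>\<zeta>. f (cvec (plane_rotation i j t \<zeta>)) \<partial>surface_measure) = sphere_integral f"
proof -
  note inv = surface_measure_isometry_invariant[OF plane_rotation_linear plane_rotation_norm[OF assms(1)] plane_rotation_surj[OF assms(1)]]
  have "sphere_integral f = (\<integral>\<zeta>. f (cvec \<zeta>) \<partial>distr surface_measure surface_measure (plane_rotation i j t))"
    unfolding sphere_integral_def inv(1) ..
  also have "\<dots> = (\<integral>\<zeta>. f (cvec (plane_rotation i j t \<zeta>)) \<partial>surface_measure)"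
    by (rule integral_distr[OF inv(2)]) (rule borel_measurable_integrable[OF hom_poly_integrable[OF assms(2)]])
  finally show ?thesis ..
qed

text \<open>The derivative at \<open>t = 0\<close> of \<open>f\<close> along \<open>plane_rotation i j t\<close>.\<close>

definition rotation_generator :: "'n \<Rightarrow> 'n \<Rightarrow> (complex^'n::finite \<Rightarrow> complex) \<Rightarrow> complex^'n \<Rightarrow> complex" where
  "rotation_generator i j f z = z $ i * cpartial j f z - z $ j * cpartial i f z"

lemma rotation_generator_hom: "f \<in> hom_polys m \<Longrightarrow> rotation_generator i j f \<in> hom_polys m"
proof (cases m)
  case 0
  assume "f \<in> hom_polys m"
  then show ?thesis using 0 hom_polys_0D[of f] by (auto simp: rotation_generator_def[abs_def] hom_polys_zero)
next
  case (Suc k)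
  assume f: "f \<in> hom_polys m"
  have "cpartial l f \<in> hom_polys k" for l using cpartial_hom[OF f] Suc by simp
  then show ?thesis unfolding rotation_generator_def[abs_def] Suc by (intro hom_polys_diff hom_polys_var)
qed

lemma cos_bound: "\<bar>cos t - 1\<bar> \<le> t\<^sup>2" for t :: real
proof -
  have "cos t = 1 - 2 * (sin (t / 2))\<^sup>2" using cos_double_sin[of "t / 2"] by simp
  moreover have "(sin (t / 2))\<^sup>2 \<le> (t / 2)\<^sup>2"
    using abs_sin_x_le_abs_x[of "t / 2"] by (metis abs_le_square_iff)
  then have "4 * (sin (t / 2))\<^sup>2 \<le> t\<^sup>2" by (simp add: power_divide)
  ultimately show ?thesis using zero_le_power2[of "sin (t / 2)"] by linarith
qed

lemma sin_bound: "\<bar>sin t - t\<bar> \<le> t\<^sup>2" for t :: real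
proof -
  have "2 * \<bar>sin t - t\<bar> \<le> t\<^sup>2"
    using Maclaurin_sin_bound[of t 2] by (simp add: numeral_2_eq_2 sin_coeff_def)
  then show ?thesis by (rule order_trans[rotated]) simp
qed

text \<open>A first-order Taylor expansion with a remainder that is uniform on the sphere, so that it can be integrated. The
coordinate functions inherit it from sine and cosine, and it is preserved by products because polynomials are bounded on
the sphere.\<close>

lemma rotation_expansion:
  fixes f :: "complex^'n::finite \<Rightarrow> complex"
  assumes "i \<noteq> j" "f \<in> hom_polys m"
  shows "\<exists>C. \<forall>x t. norm x = 1 \<longrightarrow> \<bar>t\<bar> \<le> 1 \<longrightarrow>
    norm (f (cvec (plane_rotation i j t x)) - f (cvec x) - of_real t * rotation_generator i j f (cvec x)) \<le> C * t\<^sup>2"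
  using assms(2)
proof (induction rule: hom_polys_induct)
  case (const c)
  show ?case by (rule exI[of _ 0]) (simp add: rotation_generator_def)
next
  case (add m f g)
  then obtain C D where C: "\<And>x t. norm x = 1 \<Longrightarrow> \<bar>t\<bar> \<le> 1 \<Longrightarrow>
      norm (f (cvec (plane_rotation i j t x)) - f (cvec x) - of_real t * rotation_generator i j f (cvec x)) \<le> C * t\<^sup>2"
    and D: "\<And>x t. norm x = 1 \<Longrightarrow> \<bar>t\<bar> \<le> 1 \<Longrightarrow>
      norm (g (cvec (plane_rotation i j t x)) - g (cvec x) - of_real t * rotation_generator i j g (cvec x)) \<le> D * t\<^sup>2"
    by metis
  have eq: "(f y + g y) - (f x + g x) - t * rotation_generator i j (\<lambda>z. f z + g z) x
      = (f y - f x - t * rotation_generator i j f x) + (g y - g x - t * rotation_generator i j g x)" for x y t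
    by (simp add: rotation_generator_def cpartial_add[OF add(1,2)] algebra_simps)
  show ?case
    unfolding eq by (rule exI[of _ "C + D"]) (auto simp: distrib_right intro!: norm_triangle_mono C D)
next
  case (var m f k)
  then obtain C where C: "\<And>x t. norm x = 1 \<Longrightarrow> \<bar>t\<bar> \<le> 1 \<Longrightarrow>
      norm (f (cvec (plane_rotation i j t x)) - f (cvec x) - of_real t * rotation_generator i j f (cvec x)) \<le> C * t\<^sup>2"
    by metis
  obtain B where B: "0 \<le> B" "\<And>x. norm x = 1 \<Longrightarrow> norm (f (cvec x)) \<le> B"
    using hom_poly_bounded_sphere[OF var(1)] by metis
  obtain A where A: "0 \<le> A" "\<And>x. norm x = 1 \<Longrightarrow> norm (rotation_generator i j f (cvec x)) \<le> A"
    using hom_poly_bounded_sphere[OF rotation_generator_hom[OF var(1)]] by metis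
  have C0: "0 \<le> C" using order_trans[OF norm_ge_zero C[of "axis i 1" 1]] by simp
  define a where "a x = (if k = j then x $ i else if k = i then - x $ j else 0)" for x :: "complex^'n"
  have ang: "rotation_generator i j (\<lambda>z. z $ k * f z) x = a x * f x + x $ k * rotation_generator i j f x" for x
    unfolding rotation_generator_def cpartial_var[OF var(1)] a_def using assms(1) by (auto simp: algebra_simps)
  show ?case
  proof (intro exI allI impI)
    fix x :: "real^'n" and t :: real assume x: "norm x = 1" and t: "\<bar>t\<bar> \<le> 1"
    define y where "y = plane_rotation i j t x"
    have y: "norm y = 1" unfolding y_def using plane_rotation_norm[OF assms(1)] x by simp
    have le1: "\<bar>x $ l\<bar> \<le> 1" for l using component_le_norm_cart[of x l] x by simp
    have a: "norm (a (cvec x)) \<le> 1" unfolding a_def using le1 by (auto simp: cvec_def)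
    \<comment> \<open>the remainder for the coordinate \<open>z\<^sub>k\<close>, which is real on the real sphere\<close>
    define \<rho> where "\<rho> = y $ k - x $ k - t * Re (a (cvec x))"
    have \<rho>: "cvec y $ k - cvec x $ k - of_real t * a (cvec x) = of_real \<rho>"
      unfolding \<rho>_def a_def by (auto simp: cvec_def)
    have "\<bar>\<rho>\<bar> \<le> 2 * t\<^sup>2"
    proof -
      have *: "\<bar>r * x $ l + s * x $ l'\<bar> \<le> 2 * t\<^sup>2" if "\<bar>r\<bar> \<le> t\<^sup>2" "\<bar>s\<bar> \<le> t\<^sup>2" for r s l l'
      proof -
        have "\<bar>r * x $ l\<bar> \<le> t\<^sup>2 * 1" "\<bar>s * x $ l'\<bar> \<le> t\<^sup>2 * 1"
          unfolding abs_mult by (intro mult_mono that le1; simp)+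
        then show ?thesis by linarith
      qed
      consider "k = i" | "k = j" | "k \<noteq> i" "k \<noteq> j" by blast
      then show ?thesis
      proof cases
        case 1
        then have "\<rho> = (cos t - 1) * x $ i + (t - sin t) * x $ j"
          using assms(1) by (simp add: \<rho>_def y_def plane_rotation_def a_def cvec_def algebra_simps)
        then show ?thesis using *[OF cos_bound, of "t - sin t"] sin_bound[of t] by (simp add: abs_minus_commute)
      next
        case 2
        then have "\<rho> = (cos t - 1) * x $ j + (sin t - t) * x $ i"
          using assms(1) by (simp add: \<rho>_def y_def plane_rotation_def a_def cvec_def algebra_simps)
        then show ?thesis using *[OF cos_bound sin_bound[of t]] by simp
      next
        case 3
        then show ?thesis by (simp add: \<rho>_def y_def plane_rotation_def a_def)
      qed
    qed
    then have n1: "norm (of_real \<rho> * f (cvec y)) \<le> 2 * t\<^sup>2 * B"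
      unfolding norm_mult using B(1) B(2)[OF y] by (intro mult_mono) auto
    have n2: "norm (cvec x $ k * (f (cvec y) - f (cvec x) - of_real t * rotation_generator i j f (cvec x))) \<le> 1 * (C * t\<^sup>2)"
      unfolding norm_mult y_def using C[OF x t] le1 C0 by (intro mult_mono) (auto simp: cvec_def)
    have n3: "norm (of_real t * a (cvec x) * (f (cvec y) - f (cvec x))) \<le> t\<^sup>2 * (C + A)"
    proof -
      have t2: "t\<^sup>2 \<le> \<bar>t\<bar>"
        using mult_left_le[OF t abs_ge_zero[of t]] by (simp add: power2_eq_square)
      have "norm (f (cvec y) - f (cvec x)) \<le> norm (f (cvec y) - f (cvec x) - of_real t * rotation_generator i j f (cvec x))
          + norm (of_real t * rotation_generator i j f (cvec x))"
        using norm_triangle_ineq[of "f (cvec y) - f (cvec x) - of_real t * rotation_generator i j f (cvec x)" "of_real t * rotation_generator i j f (cvec x)"] by simp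
      also have "\<dots> \<le> C * t\<^sup>2 + \<bar>t\<bar> * A"
        using C[OF x t] A(2)[OF x] unfolding y_def norm_mult by (intro add_mono mult_mono) auto
      also have "\<dots> \<le> C * \<bar>t\<bar> + \<bar>t\<bar> * A"
        using C0 t2 by (intro add_mono mult_left_mono) simp_all
      finally have "norm (f (cvec y) - f (cvec x)) \<le> \<bar>t\<bar> * (C + A)" by (simp add: algebra_simps)
      then have "\<bar>t\<bar> * norm (a (cvec x)) * norm (f (cvec y) - f (cvec x)) \<le> \<bar>t\<bar> * 1 * (\<bar>t\<bar> * (C + A))"
        using a by (intro mult_mono) auto
      also have "\<dots> = t\<^sup>2 * (C + A)" by (simp add: power2_eq_square)
      finally show ?thesis by (simp add: norm_mult)
    qed
    \<comment> \<open>the remainder for \<open>z\<^sub>k f\<close> in terms of those for \<open>z\<^sub>k\<close> and \<open>f\<close>\<close>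
    have eq: "cvec y $ k * f (cvec y) - cvec x $ k * f (cvec x) - of_real t * rotation_generator i j (\<lambda>z. z $ k * f z) (cvec x)
       = of_real \<rho> * f (cvec y) + cvec x $ k * (f (cvec y) - f (cvec x) - of_real t * rotation_generator i j f (cvec x))
         + of_real t * a (cvec x) * (f (cvec y) - f (cvec x))"
      unfolding ang \<rho>[symmetric] by (simp add: algebra_simps)
    have "norm (cvec y $ k * f (cvec y) - cvec x $ k * f (cvec x) - of_real t * rotation_generator i j (\<lambda>z. z $ k * f z) (cvec x))
        \<le> 2 * t\<^sup>2 * B + 1 * (C * t\<^sup>2) + t\<^sup>2 * (C + A)"
      unfolding eq by (rule norm_triangle_mono[OF norm_triangle_mono[OF n1 n2] n3])
    then show "norm (cvec (plane_rotation i j t x) $ k * f (cvec (plane_rotation i j t x)) - cvec x $ k * f (cvec x)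
        - of_real t * rotation_generator i j (\<lambda>z. z $ k * f z) (cvec x)) \<le> (2 * B + C + (C + A)) * t\<^sup>2"
      unfolding y_def by (simp add: algebra_simps)
  qed
qed

text \<open>The rotated and the original polynomial have the same integral, so integrating the expansion over the sphere
bounds \<open>|t|\<close> times the integral in question by a multiple of \<open>t\<^sup>2\<close>, for all small \<open>t\<close>.\<close>

lemma sphere_integral_rotation_generator:
  assumes f: "f \<in> hom_polys m"
  shows "sphere_integral (rotation_generator i j f) = 0"
proof (cases "i = j")
  case True
  then show ?thesis by (simp add: rotation_generator_def sphere_integral_def)
next
  case False
  interpret prob_space "surface_measure :: (real^'a) measure" by (rule prob_space_surface_measure)
  obtain C where C: "\<And>x t. norm x = 1 \<Longrightarrow> \<bar>t\<bar> \<le> 1 \<Longrightarrow>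
      norm (f (cvec (plane_rotation i j t x)) - f (cvec x) - of_real t * rotation_generator i j f (cvec x)) \<le> C * t\<^sup>2"
    using rotation_expansion[OF False f] by metis
  have int: "integrable surface_measure (\<lambda>x. f (cvec (plane_rotation i j t x)))" for t
  proof (rule continuous_integrable_sphere)
    have "continuous_on UNIV (\<lambda>x. cvec (plane_rotation i j t x))"
      using plane_rotation_linear by (intro continuous_cvec linear_continuous_on) (simp add: linear_linear)
    then show "continuous_on UNIV (\<lambda>x. f (cvec (plane_rotation i j t x)))"
      by (rule continuous_on_compose2[OF hom_polys_continuous[OF f]]) simp
  qed
  note ints = int hom_poly_integrable[OF f] hom_poly_integrable[OF rotation_generator_hom[OF f]]
  have bound: "\<bar>t\<bar> * norm (sphere_integral (rotation_generator i j f)) \<le> C * t\<^sup>2" if t: "\<bar>t\<bar> \<le> 1" for t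
  proof -
    have "(\<integral>x. f (cvec (plane_rotation i j t x)) - f (cvec x) - of_real t * rotation_generator i j f (cvec x) \<partial>surface_measure)
        = - of_real t * sphere_integral (rotation_generator i j f)"
      using ints sphere_integral_rotation[OF False f, of t] by (simp add: sphere_integral_def)
    moreover have "norm (\<integral>x. f (cvec (plane_rotation i j t x)) - f (cvec x) - of_real t * rotation_generator i j f (cvec x) \<partial>surface_measure)
        \<le> (\<integral>x. norm (f (cvec (plane_rotation i j t x)) - f (cvec x) - of_real t * rotation_generator i j f (cvec x)) \<partial>surface_measure)"
      by (rule integral_norm_bound)
    moreover have "\<dots> \<le> (\<integral>x. C * t\<^sup>2 \<partial>(surface_measure :: (real^'a) measure))"
      by (rule integral_mono) (use ints C t in \<open>auto\<close>)
    ultimately show ?thesis by (simp add: norm_mult prob_space[unfolded space_surface_measure])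
  qed
  have "norm (sphere_integral (rotation_generator i j f)) \<le> C" using bound[of 1] by simp
  then have C0: "0 \<le> C" by (rule order_trans[OF norm_ge_zero])
  have lin: "norm (sphere_integral (rotation_generator i j f)) \<le> C * t" if "0 < t" "t \<le> 1" for t
    using bound[of t] that by (simp add: power2_eq_square mult.left_commute)
  have "norm (sphere_integral (rotation_generator i j f)) \<le> 0 + e" if "0 < e" for e
  proof -
    have pos: "0 < min 1 (e / (C + 1))" using that C0 by simp
    have "norm (sphere_integral (rotation_generator i j f)) \<le> C * min 1 (e / (C + 1))"
      by (rule lin[OF pos]) simp
    also have "\<dots> \<le> (C + 1) * (e / (C + 1))" using C0 that by (intro mult_mono) auto
    finally show ?thesis using C0 by simp
  qed
  then have "norm (sphere_integral (rotation_generator i j f)) \<le> 0" by (rule field_le_epsilon)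
  then show ?thesis by simp
qed

lemma sphere_integral_add:
  "f \<in> hom_polys m \<Longrightarrow> g \<in> hom_polys k \<Longrightarrow> sphere_integral (\<lambda>z. f z + g z) = sphere_integral f + sphere_integral g"
  unfolding sphere_integral_def by (intro Bochner_Integration.integral_add hom_poly_integrable)

lemma sphere_integral_scale:
  "sphere_integral (\<lambda>z. c * f z) = c * sphere_integral f"
  unfolding sphere_integral_def by simp

lemma sphere_integral_sum:
  "(\<And>k. k \<in> A \<Longrightarrow> f k \<in> hom_polys m) \<Longrightarrow> sphere_integral (\<lambda>z. \<Sum>k\<in>A. f k z) = (\<Sum>k\<in>A. sphere_integral (f k))"
  unfolding sphere_integral_def by (intro Bochner_Integration.integral_sum hom_poly_integrable)

text \<open>The left-hand side is half the sum of the squares of all rotation generators, that is, the Laplacian of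
the sphere; the identity expresses it in polar form for a homogeneous polynomial of degree \<open>m\<close>.\<close>

lemma sum_rotation_generator:
  fixes f :: "complex^'n::finite \<Rightarrow> complex"
  assumes f: "f \<in> hom_polys m"
  shows "(\<Sum>i\<in>UNIV. \<Sum>j\<in>UNIV. rotation_generator i j (\<lambda>z. z $ i * cpartial j f z) z)
     = square_sum z * claplacian f z + (- of_nat (m * (m + CARD('n) - 2))) * f z"
proof (cases m)
  case 0
  then obtain c where "f = (\<lambda>z. c)" using hom_polys_0D f by blast
  then show ?thesis using 0 by (simp add: rotation_generator_def)
next
  case (Suc k)
  have e: "(\<Sum>j\<in>UNIV. z $ j * cpartial j (cpartial i f) z) = of_nat k * cpartial i f z" for i
    using euler_identity[OF cpartial_hom[OF f]] Suc by simp
  have "rotation_generator i j (\<lambda>z. z $ i * cpartial j f z) z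
     = (if j = i then z $ i * cpartial i f z else 0) + (z $ i)\<^sup>2 * cpartial j (cpartial j f) z
       - z $ j * cpartial j f z - z $ i * (z $ j * cpartial j (cpartial i f) z)" for i j
    unfolding rotation_generator_def cpartial_var[OF cpartial_hom[OF f]] cpartial_commute[OF f, of i j]
    by (auto simp: power2_eq_square algebra_simps)
  then have "(\<Sum>i\<in>UNIV. \<Sum>j\<in>UNIV. rotation_generator i j (\<lambda>z. z $ i * cpartial j f z) z)
     = (\<Sum>i\<in>UNIV. z $ i * cpartial i f z) + (\<Sum>i\<in>UNIV. \<Sum>j\<in>UNIV. (z $ i)\<^sup>2 * cpartial j (cpartial j f) z)
       - of_nat CARD('n) * (\<Sum>j\<in>UNIV. z $ j * cpartial j f z)
       - (\<Sum>i\<in>UNIV. z $ i * (\<Sum>j\<in>UNIV. z $ j * cpartial j (cpartial i f) z))"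
    by (simp add: sum.distrib sum_subtractf sum_distrib_left)
  also have "(\<Sum>i\<in>UNIV. \<Sum>j\<in>UNIV. (z $ i)\<^sup>2 * cpartial j (cpartial j f) z) = square_sum z * claplacian f z"
    by (simp add: square_sum_def claplacian_def sum_product)
  also have "(\<Sum>i\<in>UNIV. z $ i * (\<Sum>j\<in>UNIV. z $ j * cpartial j (cpartial i f) z))
      = of_nat k * (\<Sum>i\<in>UNIV. z $ i * cpartial i f z)"
    unfolding e by (simp add: sum_distrib_left mult_ac)
  also note euler_identity[OF f]
  finally have "(\<Sum>i\<in>UNIV. \<Sum>j\<in>UNIV. rotation_generator i j (\<lambda>z. z $ i * cpartial j f z) z)
     = square_sum z * claplacian f z + (of_nat m - of_nat CARD('n) * of_nat m - of_nat k * of_nat m) * f z"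
    by (simp add: algebra_simps)
  also have "of_nat m - of_nat CARD('n) * of_nat m - of_nat k * of_nat m = - (of_nat (m * (m + CARD('n) - 2)) :: complex)"
    unfolding Suc by (cases "CARD('n)") (simp_all add: algebra_simps)
  finally show ?thesis .
qed

text \<open>The rotation generators integrate to zero, and \<open>square_sum\<close> is 1 on the real unit sphere.\<close>

lemma sphere_integral_claplacian:
  fixes f :: "complex^'n::finite \<Rightarrow> complex"
  assumes f: "f \<in> hom_polys m"
  shows "sphere_integral (claplacian f) = of_nat (m * (m + CARD('n) - 2)) * sphere_integral f"
proof -
  have g: "(\<lambda>z. z $ i * cpartial j f z) \<in> hom_polys m" for i j
  proof (cases m)
    case 0
    then show ?thesis using hom_polys_0D[of f] f by (auto simp: hom_polys_zero)
  next
    case (Suc k)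
    then show ?thesis using hom_polys_var[OF cpartial_hom[OF f, of j], of i] by simp
  qed
  have "0 = sphere_integral (\<lambda>z. \<Sum>i\<in>UNIV. \<Sum>j\<in>UNIV. rotation_generator i j (\<lambda>z. z $ i * cpartial j f z) z)"
    using sphere_integral_sum[of UNIV "\<lambda>i z. \<Sum>j\<in>UNIV. rotation_generator i j (\<lambda>z. z $ i * cpartial j f z) z" m]
      sphere_integral_sum[of UNIV "\<lambda>j. rotation_generator i j (\<lambda>z. z $ i * cpartial j f z)" m for i]
    by (simp add: hom_polys_sum rotation_generator_hom g sphere_integral_rotation_generator[OF g])
  also have "\<dots> = sphere_integral (\<lambda>z. square_sum z * claplacian f z)
      - of_nat (m * (m + CARD('n) - 2)) * sphere_integral f"
    unfolding sum_rotation_generator[OF f]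
      sphere_integral_add[OF square_sum_claplacian_hom[OF f] hom_polys_scale[OF f]] sphere_integral_scale
    by simp
  also have "sphere_integral (\<lambda>z. square_sum z * claplacian f z) = sphere_integral (claplacian f)"
    unfolding sphere_integral_def by (rule Bochner_Integration.integral_cong) (auto simp: square_sum_cvec)
  finally show ?thesis by simp
qed

text \<open>By the preceding identity it suffices that the Laplacian of the product \<open>q v\<close> integrates to zero. It consists of
\<open>v \<Delta>q\<close> and of \<open>2 \<Sum>\<^sub>j \<partial>\<^sub>j q \<partial>\<^sub>j v\<close>, where \<open>\<partial>\<^sub>j v\<close> is again harmonic; in each product the first factor has degree
less than \<open>b\<close> and still less than the degree of the harmonic factor.\<close>

lemma harmonic_orthogonal_lower_degree:
  fixes q v :: "complex^'n::finite \<Rightarrow> complex"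
  assumes "CARD('n) \<ge> 2" "q \<in> hom_polys b" "v \<in> hom_polys a" "claplacian v = (\<lambda>z. 0)" "b < a"
  shows "sphere_integral (\<lambda>z. q z * v z) = 0"
  using assms(2-5)
proof (induction b arbitrary: a q v rule: less_induct)
  case (less b)
  note q = less.prems(1) and v = less.prems(2)
  have qv: "(\<lambda>z. q z * v z) \<in> hom_polys (b + a)" by (rule hom_polys_mult[OF q v])
  have "sphere_integral (\<lambda>z. claplacian q z * v z) = 0"
  proof (cases "b < 2")
    case True
    then show ?thesis using claplacian_low_degree[OF q] by (simp add: sphere_integral_def)
  next
    case False
    then show ?thesis using less.IH[OF _ claplacian_hom[OF q] v less.prems(3)] less.prems(4) by simp
  qed
  moreover have grad: "sphere_integral (\<lambda>z. cpartial j q z * cpartial j v z) = 0" for j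
  proof (cases "b = 0")
    case True
    then show ?thesis using hom_polys_0D[of q] q by (auto simp: sphere_integral_def)
  next
    case False
    have "claplacian (cpartial j v) = (\<lambda>z. 0)" using claplacian_cpartial[OF v] less.prems(3) by simp
    then show ?thesis
      using less.IH[OF _ cpartial_hom[OF q] cpartial_hom[OF v]] less.prems(4) False by simp
  qed
  moreover have "claplacian (\<lambda>z. q z * v z) = (\<lambda>z. 2 * (\<Sum>j\<in>UNIV. cpartial j q z * cpartial j v z) + claplacian q z * v z)"
    unfolding claplacian_mult[OF q v, abs_def] less.prems(3) by simp
  ultimately have "sphere_integral (claplacian (\<lambda>z. q z * v z)) = 0"
    by (simp add: sphere_integral_scale sphere_integral_sum[OF hom_polys_mult[OF cpartial_hom[OF q] cpartial_hom[OF v]]]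
        sphere_integral_add[OF hom_polys_scale[OF hom_polys_sum[OF hom_polys_mult[OF cpartial_hom[OF q] cpartial_hom[OF v]]]]
          hom_polys_mult[OF claplacian_hom[OF q] v]])
  then have "of_nat ((b + a) * (b + a + CARD('n) - 2)) * sphere_integral (\<lambda>z. q z * v z) = 0"
    using sphere_integral_claplacian[OF qv] by (simp only:)
  moreover have "(b + a) * (b + a + CARD('n) - 2) \<noteq> 0" using assms(1) less.prems(4) by simp
  ultimately show ?case unfolding mult_eq_0_iff of_nat_eq_0_iff by blast
qed

section \<open>The canonical projection on the rotated spheres\<close>

text \<open>Conjugating the coefficients moves the conjugation in the inner product from the harmonic factor to the other one,
so that \<open>harmonic_orthogonal_lower_degree\<close> applies to a product of two polynomials.\<close>

lemma hom_polys_conjugate: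
  "f \<in> hom_polys m \<Longrightarrow> \<exists>g\<in>hom_polys m. \<forall>x. g (cvec x) = cnj (f (cvec x))"
proof (induction rule: hom_polys_induct)
  case (const c)
  then show ?case by (auto intro!: bexI[of _ "\<lambda>z. cnj c"] hom_polys_const)
next
  case (add m f g)
  then obtain f' g' where "f' \<in> hom_polys m" "g' \<in> hom_polys m"
    "\<forall>x. f' (cvec x) = cnj (f (cvec x))" "\<forall>x. g' (cvec x) = cnj (g (cvec x))" by blast
  then show ?case by (auto intro!: bexI[of _ "\<lambda>z. f' z + g' z"] hom_polys_add)
next
  case (var m f i)
  then obtain f' where "f' \<in> hom_polys m" "\<forall>x. f' (cvec x) = cnj (f (cvec x))" by blast
  then show ?case by (auto intro!: bexI[of _ "\<lambda>z. z $ i * f' z"] hom_polys_var simp: cvec_def)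
qed

lemma square_sum_scale: "square_sum (c *s z) = c\<^sup>2 * square_sum z"
  by (simp add: square_sum_def power_mult_distrib sum_distrib_left)

lemma rotated_spheres_point:
  "l < p \<Longrightarrow> norm x = 1 \<Longrightarrow> cis (real l * pi / real p) *s cvec x \<in> rotated_spheres p"
  unfolding rotated_spheres_def by (intro UN_I[of l] imageI) auto

lemma restr_rotated_spheres_inject:
  fixes u w :: "complex^'n::finite \<Rightarrow> complex"
  assumes "u \<in> hom_polys m" "w \<in> hom_polys m" "p \<ge> 1"
    and eq: "restr (rotated_spheres p) u = restr (rotated_spheres p) w"
  shows "u = w"
proof (rule hom_polys_eq_on_sphere[OF assms(1,2)])
  fix x :: "real^'n" assume "norm x = 1"
  then have "cvec x \<in> rotated_spheres p" using rotated_spheres_point[of 0 p x] assms(3) by simp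
  then show "u (cvec x) = w (cvec x)" using fun_cong[OF eq, of "cvec x"] by (simp add: restr_def)
qed

lemma polyharmonic_polys_lincomb:
  assumes "f \<in> polyharmonic_polys p m" "g \<in> polyharmonic_polys p m"
  shows "(\<lambda>z. a * f z + b * g z) \<in> polyharmonic_polys p m"
  using assms unfolding polyharmonic_polys_def
  by (auto simp: claplacian_funpow_add[OF hom_polys_scale hom_polys_scale] claplacian_funpow_scale
      intro: hom_polys_add hom_polys_scale)

text \<open>On the real sphere \<open>h\<close> is the sum of the \<open>v\<^sub>k\<close>, whose degrees \<open>m - 2k\<close> exceed the degree \<open>m - 2p\<close> of \<open>q\<close>.\<close>

lemma polyharmonic_orthogonal:
  fixes q h :: "complex^'n::finite \<Rightarrow> complex"
  assumes n: "CARD('n) \<ge> 2" and m: "2 * p \<le> m" and q: "q \<in> hom_polys (m - 2 * p)"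
    and h: "h = (\<lambda>z. \<Sum>k<p. square_sum z ^ k * v k z)"
    and v: "\<And>k. k < p \<Longrightarrow> v k \<in> hom_polys (m - 2 * k)" "\<And>k. k < p \<Longrightarrow> claplacian (v k) = (\<lambda>z. 0)"
  shows "(\<integral>\<zeta>. q (cvec \<zeta>) * cnj (h (cvec \<zeta>)) \<partial>surface_measure) = 0"
proof -
  obtain q' where q': "q' \<in> hom_polys (m - 2 * p)" "\<And>x. q' (cvec x) = cnj (q (cvec x))"
    using hom_polys_conjugate[OF q] by blast
  have "(\<integral>\<zeta>. q (cvec \<zeta>) * cnj (h (cvec \<zeta>)) \<partial>surface_measure)
      = (\<integral>\<zeta>. cnj (\<Sum>k<p. q' (cvec \<zeta>) * v k (cvec \<zeta>)) \<partial>surface_measure)"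
    by (rule Bochner_Integration.integral_cong)
      (auto simp: h q'(2) square_sum_cvec sum_distrib_left)
  also have "\<dots> = cnj (\<Sum>k<p. sphere_integral (\<lambda>z. q' z * v k z))"
  proof -
    have "integrable surface_measure (\<lambda>\<zeta>. q' (cvec \<zeta>) * v k (cvec \<zeta>))" if "k < p" for k
      by (rule hom_poly_integrable[OF hom_polys_mult[OF q'(1) v(1)[OF that]]])
    then have "(\<integral>\<zeta>. (\<Sum>k<p. q' (cvec \<zeta>) * v k (cvec \<zeta>)) \<partial>surface_measure)
        = (\<Sum>k<p. sphere_integral (\<lambda>z. q' z * v k z))"
      unfolding sphere_integral_def by (intro Bochner_Integration.integral_sum) simp
    then show ?thesis by (simp only: Bochner_Integration.integral_cnj)
  qed
  also have "\<dots> = 0"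
    using harmonic_orthogonal_lower_degree[OF n q'(1) v] m by simp
  finally show ?thesis .
qed

text \<open>At \<open>c \<zeta>\<close> with \<open>c = e\<^bsup>ij\<pi>/p\<^esup>\<close> the factor \<open>s\<^sup>p\<close> is \<open>c\<^bsup>2p\<^esup> = 1\<close>, and homogeneity produces \<open>c\<^bsup>m-2p\<^esup>\<close> times the conjugate
of \<open>c\<^sup>m\<close>, which is the conjugate of \<open>c\<^bsup>2p\<^esup>\<close>. So all \<open>p\<close> summands are equal.\<close>

lemma spheres_inner_square_sum_multiple:
  assumes p: "p \<ge> 1" and m: "2 * p \<le> m" and q: "q \<in> hom_polys (m - 2 * p)" and h: "h \<in> hom_polys m"
    and f: "\<And>z. z \<in> rotated_spheres p \<Longrightarrow> f z = square_sum z ^ p * q z"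
    and g: "\<And>z. z \<in> rotated_spheres p \<Longrightarrow> g z = h z"
  shows "spheres_inner p f g = (\<integral>\<zeta>. q (cvec \<zeta>) * cnj (h (cvec \<zeta>)) \<partial>surface_measure)"
proof -
  have "f (cis (real j * pi / real p) *s cvec \<zeta>) * cnj (g (cis (real j * pi / real p) *s cvec \<zeta>))
      = q (cvec \<zeta>) * cnj (h (cvec \<zeta>))" if "norm \<zeta> = 1" "j < p" for \<zeta> j
  proof -
    define c where "c = cis (real j * pi / real p)"
    have c2p: "c ^ (2 * p) = 1"
    proof -
      have "c ^ (2 * p) = cis (real (2 * p) * (real j * pi / real p))" unfolding c_def by (rule Complex.DeMoivre)
      also have "real (2 * p) * (real j * pi / real p) = 2 * pi * real j" using p by simp
      finally show ?thesis using cis_multiple_2pi[of "real j"] by simp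
    qed
    have cc: "c * cnj c = 1" unfolding c_def by (simp add: cis_cnj cis_mult)
    obtain e where e: "m = e + 2 * p" using m by (metis le_add_diff_inverse2)
    have "c ^ (m - 2 * p) * cnj (c ^ m) = (c * cnj c) ^ e * cnj (c ^ (2 * p))"
      unfolding e by (simp add: power_add power_mult_distrib)
    then have 1: "c ^ (m - 2 * p) * cnj (c ^ m) = 1" unfolding cc c2p by simp
    have "square_sum (c *s cvec \<zeta>) ^ p = c ^ (2 * p)"
      by (simp add: square_sum_scale square_sum_cvec that power_mult)
    then have "f (c *s cvec \<zeta>) * cnj (g (c *s cvec \<zeta>)) = q (c *s cvec \<zeta>) * cnj (h (c *s cvec \<zeta>))"
      using rotated_spheres_point[OF that(2,1)] c2p by (simp add: f g c_def)
    also have "\<dots> = (c ^ (m - 2 * p) * cnj (c ^ m)) * (q (cvec \<zeta>) * cnj (h (cvec \<zeta>)))"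
      by (simp add: hom_polys_homogeneous[OF q] hom_polys_homogeneous[OF h])
    also have "\<dots> = q (cvec \<zeta>) * cnj (h (cvec \<zeta>))" unfolding 1 by simp
    finally show ?thesis unfolding c_def .
  qed
  then have "(\<integral>\<zeta>. (\<Sum>j<p. f (cis (real j * pi / real p) *s cvec \<zeta>) * cnj (g (cis (real j * pi / real p) *s cvec \<zeta>))) \<partial>surface_measure)
      = (\<integral>\<zeta>. of_nat p * (q (cvec \<zeta>) * cnj (h (cvec \<zeta>))) \<partial>surface_measure)"
    by (intro Bochner_Integration.integral_cong) auto
  then show ?thesis unfolding spheres_inner_def using p by simp
qed

text \<open>The harmonic expansion of \<open>u\<close>, cut off at \<open>k = p\<close>; the inequality \<open>2 * p \<le> m\<close> keeps all terms with
\<open>k < p\<close> away from the exceptional term of the planar case.\<close>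

lemma canonical_proj_expansion:
  fixes d :: "nat \<Rightarrow> ('n::finite \<Rightarrow> nat) \<Rightarrow> complex" and u :: "complex^'n \<Rightarrow> complex"
  assumes n: "CARD('n) \<ge> 2" and d: "kelvin_constants m d" and m: "2 * p \<le> m" and u: "u \<in> hom_polys m"
  obtains v q where "\<And>k. k < p \<Longrightarrow> v k \<in> hom_polys (m - 2 * k)"
    "\<And>k. k < p \<Longrightarrow> claplacian (v k) = (\<lambda>z. 0)"
    "q \<in> hom_polys (m - 2 * p)"
    "canonical_proj p m u \<in> polyharmonic_polys p m"
    "canonical_proj p m u = (\<lambda>z. \<Sum>k<p. square_sum z ^ k * v k z)"
    "u = (\<lambda>z. canonical_proj p m u z + square_sum z ^ p * q z)"
    "\<And>k x. k < p \<Longrightarrow> norm x = 1 \<Longrightarrow> CARD('n) > 2 \<Longrightarrow>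
       poly_diff_op (assoc_poly d (u \<circ> cvec) k) norm_power x / of_real (kelvin_c CARD('n) (m - 2 * k)) = v k (cvec x)"
    "\<And>k x. k < p \<Longrightarrow> norm x = 1 \<Longrightarrow> CARD('n) = 2 \<Longrightarrow>
       poly_diff_op (assoc_poly d (u \<circ> cvec) k) log_norm x / of_real (kelvin_c2 (m - 2 * k)) = v k (cvec x)"
proof -
  obtain v where v: "\<And>k. 2 * k \<le> m \<Longrightarrow> v k \<in> hom_polys (m - 2 * k)"
    "\<And>k. 2 * k < m \<Longrightarrow> claplacian (v k) = (\<lambda>z. 0)"
    "u = (\<lambda>z. \<Sum>k\<le>m div 2. square_sum z ^ k * v k z)"
    "\<And>k x. 2 * k < m \<Longrightarrow> norm x = 1 \<Longrightarrow> CARD('n) > 2 \<Longrightarrow>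
       poly_diff_op (assoc_poly d (u \<circ> cvec) k) norm_power x / of_real (kelvin_c CARD('n) (m - 2 * k)) = v k (cvec x)"
    "\<And>k x. 2 * k < m \<Longrightarrow> norm x = 1 \<Longrightarrow> CARD('n) = 2 \<Longrightarrow>
       poly_diff_op (assoc_poly d (u \<circ> cvec) k) log_norm x / of_real (kelvin_c2 (m - 2 * k)) = v k (cvec x)"
    by (rule harmonic_expansion[OF n d u]) (rule that; assumption)
  have low: "2 * k < m" if "k < p" for k using that m by simp
  obtain q where q: "q \<in> hom_polys (m - 2 * p)"
    "(\<lambda>z. \<Sum>k<p. square_sum z ^ k * v k z) \<in> polyharmonic_polys p m"
    "u = (\<lambda>z. (\<Sum>k<p. square_sum z ^ k * v k z) + square_sum z ^ p * q z)"
    "canonical_proj p m u = (\<lambda>z. \<Sum>k<p. square_sum z ^ k * v k z)"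
    by (rule canonical_proj_almansi[OF m v(1) v(2)[OF low] v(3)])
  show ?thesis
  proof (rule that[of v q])
    show "v k \<in> hom_polys (m - 2 * k)" if "k < p" for k
      by (rule v(1)) (use low[OF that] in simp)
    show "canonical_proj p m u \<in> polyharmonic_polys p m" unfolding q(4) by (rule q(2))
    show "u = (\<lambda>z. canonical_proj p m u z + square_sum z ^ p * q z)" unfolding q(4) by (rule q(3))
  qed (rule v(2,4,5)[OF low] q; assumption)+
qed

theorem theorem2:
  fixes d :: "nat \<Rightarrow> ('n::finite \<Rightarrow> nat) \<Rightarrow> complex" and m p :: nat
  assumes "CARD('n) \<ge> 2" and "p \<ge> 1" and "m \<ge> 2 * p"
    and "kelvin_constants m d"
  shows "\<exists>T :: (complex^'n \<Rightarrow> complex) \<Rightarrow> (complex^'n \<Rightarrow> complex).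
     (\<forall>u\<in>hom_polys m.
        T (restr (rotated_spheres p) u) = restr (rotated_spheres p) (canonical_proj p m u)) \<and>
     is_orthogonal_projection (spheres_inner p) (hom_polys_spheres p m)
       (spherical_polyharmonics p m) T \<and>
     (\<forall>u\<in>hom_polys m. \<forall>l<p. \<forall>x\<in>sphere (0::real^'n) 1.
        (CARD('n) > 2 \<longrightarrow>
           T (restr (rotated_spheres p) u) (cis (real l * pi / real p) *s cvec x) =
             cis (real m * real l * pi / real p) *
             (\<Sum>k<p. poly_diff_op (assoc_poly d (u \<circ> cvec) k) norm_power x
                       / of_real (kelvin_c CARD('n) (m - 2 * k)))) \<and>
        (CARD('n) = 2 \<longrightarrow>
           T (restr (rotated_spheres p) u) (cis (real l * pi / real p) *s cvec x) =
             cis (real m * real l * pi / real p) *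
             (\<Sum>k<p. poly_diff_op (assoc_poly d (u \<circ> cvec) k) log_norm x
                       / of_real (kelvin_c2 (m - 2 * k)))))"
proof -
  let ?S = "rotated_spheres p :: (complex^'n) set"
  let ?Q = "canonical_proj p m :: (complex^'n \<Rightarrow> complex) \<Rightarrow> _"
  note p = assms(2) and m = assms(3)
  note expand = canonical_proj_expansion[OF assms(1,4) m]
  have Q_poly: "?Q u \<in> polyharmonic_polys p m" if "u \<in> hom_polys m" for u
    by (rule expand[OF that])
  have Q_lincomb: "?Q (\<lambda>z. a * u z + b * w z) = (\<lambda>z. a * ?Q u z + b * ?Q w z)"
    if u: "u \<in> hom_polys m" and w: "w \<in> hom_polys m" for u w a b
  proof -
    obtain q where q: "q \<in> hom_polys (m - 2 * p)" "u = (\<lambda>z. ?Q u z + square_sum z ^ p * q z)"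
      by (rule expand[OF u]) (rule that; assumption)
    obtain r where r: "r \<in> hom_polys (m - 2 * p)" "w = (\<lambda>z. ?Q w z + square_sum z ^ p * r z)"
      by (rule expand[OF w]) (rule that; assumption)
    show ?thesis
    proof (rule canonical_proj_eqI[OF polyharmonic_polys_lincomb[OF Q_poly Q_poly] m])
      show "(\<lambda>z. a * q z + b * r z) \<in> hom_polys (m - 2 * p)"
        by (intro hom_polys_add hom_polys_scale q r)
      have "u z = ?Q u z + square_sum z ^ p * q z" "w z = ?Q w z + square_sum z ^ p * r z" for z
        using fun_cong[OF q(2)] fun_cong[OF r(2)] by auto
      then show "(\<lambda>z. a * u z + b * w z)
          = (\<lambda>z. (a * ?Q u z + b * ?Q w z) + square_sum z ^ p * (a * q z + b * r z))"
        by (intro ext) (simp add: algebra_simps)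
    qed (use u w in auto)
  qed
  have Q_id: "?Q h = h" if "h \<in> polyharmonic_polys p m" for h
    by (rule canonical_proj_eqI[OF that m hom_polys_zero]) simp
  define T where "T f = restr ?S (?Q (SOME u. u \<in> hom_polys m \<and> restr ?S u = f))" for f
  have T: "T (restr ?S u) = restr ?S (?Q u)" if u: "u \<in> hom_polys m" for u
  proof -
    have "(SOME w. w \<in> hom_polys m \<and> restr ?S w = restr ?S u) = u"
      by (rule some_equality) (use u restr_rotated_spheres_inject[OF _ u p] in auto)
    then show ?thesis unfolding T_def by simp
  qed
  have poly_sub: "h \<in> hom_polys m" if "h \<in> polyharmonic_polys p m" for h :: "complex^'n \<Rightarrow> complex"
    using that by (simp add: polyharmonic_polys_def)
  have orth: "is_orthogonal_projection (spheres_inner p) (hom_polys_spheres p m) (spherical_polyharmonics p m) T"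
    unfolding is_orthogonal_projection_def
  proof (intro conjI ballI allI)
    show "(spherical_polyharmonics p m :: (complex^'n \<Rightarrow> complex) set) \<subseteq> hom_polys_spheres p m"
      unfolding spherical_polyharmonics_def hom_polys_spheres_def by (intro image_mono subsetI) (rule poly_sub)
    show "T f \<in> spherical_polyharmonics p m" if "f \<in> hom_polys_spheres p m" for f
      using that T Q_poly unfolding spherical_polyharmonics_def hom_polys_spheres_def by auto
    show "T (\<lambda>z. a * f z + b * g z) = (\<lambda>z. a * T f z + b * T g z)"
      if fg: "f \<in> hom_polys_spheres p m" "g \<in> hom_polys_spheres p m" for f g a b
    proof -
      obtain u w where uw: "u \<in> hom_polys m" "w \<in> hom_polys m" and fg': "f = restr ?S u" "g = restr ?S w"
        using fg unfolding hom_polys_spheres_def by blast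
      have "(\<lambda>z. a * f z + b * g z) = restr ?S (\<lambda>z. a * u z + b * w z)"
        unfolding fg' restr_def by auto
      then have "T (\<lambda>z. a * f z + b * g z) = restr ?S (\<lambda>z. a * ?Q u z + b * ?Q w z)"
        using T[OF hom_polys_add[OF hom_polys_scale[OF uw(1)] hom_polys_scale[OF uw(2)]]] Q_lincomb[OF uw]
        by simp
      then show ?thesis unfolding fg' T[OF uw(1)] T[OF uw(2)] by (auto simp: restr_def)
    qed
    show "T g = g" if "g \<in> spherical_polyharmonics p m" for g
      using that T[OF poly_sub] Q_id unfolding spherical_polyharmonics_def by auto
    show "spheres_inner p (\<lambda>z. f z - T f z) g = 0"
      if fV: "f \<in> hom_polys_spheres p m" and gW: "g \<in> spherical_polyharmonics p m" for f g
    proof -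
      obtain u where u: "u \<in> hom_polys m" and f: "f = restr ?S u"
        using fV unfolding hom_polys_spheres_def by auto
      obtain h where h: "h \<in> polyharmonic_polys p m" and g: "g = restr ?S h"
        using gW unfolding spherical_polyharmonics_def by blast
      obtain q where q: "q \<in> hom_polys (m - 2 * p)" "u = (\<lambda>z. ?Q u z + square_sum z ^ p * q z)"
        by (rule expand[OF u]) (rule that; assumption)
      obtain v where v: "\<And>k. k < p \<Longrightarrow> v k \<in> hom_polys (m - 2 * k)" "\<And>k. k < p \<Longrightarrow> claplacian (v k) = (\<lambda>z. 0)"
        "?Q h = (\<lambda>z. \<Sum>k<p. square_sum z ^ k * v k z)"
        by (rule expand[OF poly_sub[OF h]]) (rule that; assumption)
      have "spheres_inner p (\<lambda>z. f z - T f z) g = (\<integral>\<zeta>. q (cvec \<zeta>) * cnj (h (cvec \<zeta>)) \<partial>surface_measure)"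
      proof (rule spheres_inner_square_sum_multiple[OF p m q(1) poly_sub[OF h]])
        fix z assume z: "z \<in> ?S"
        show "g z = h z" using z by (simp add: g restr_def)
        show "f z - T f z = square_sum z ^ p * q z"
          unfolding f T[OF u] unfolding restr_def using z fun_cong[OF q(2), of z] by simp
      qed
      also have "\<dots> = 0"
        by (rule polyharmonic_orthogonal[OF assms(1) m q(1) v(3)[unfolded Q_id[OF h]] v(1,2)])
      finally show ?thesis .
    qed
  qed
  have formula: "(CARD('n) > 2 \<longrightarrow> T (restr ?S u) (cis (real l * pi / real p) *s cvec x) =
             cis (real m * real l * pi / real p) *
             (\<Sum>k<p. poly_diff_op (assoc_poly d (u \<circ> cvec) k) norm_power x
                       / of_real (kelvin_c CARD('n) (m - 2 * k)))) \<and>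
        (CARD('n) = 2 \<longrightarrow> T (restr ?S u) (cis (real l * pi / real p) *s cvec x) =
             cis (real m * real l * pi / real p) *
             (\<Sum>k<p. poly_diff_op (assoc_poly d (u \<circ> cvec) k) log_norm x
                       / of_real (kelvin_c2 (m - 2 * k))))"
    if u: "u \<in> hom_polys m" and l: "l < p" and x: "x \<in> sphere 0 1" for u l and x :: "real^'n"
  proof -
    from x have x1: "norm x = 1" by simp
    obtain v where v: "?Q u = (\<lambda>z. \<Sum>k<p. square_sum z ^ k * v k z)"
      "\<And>k x. k < p \<Longrightarrow> norm x = 1 \<Longrightarrow> CARD('n) > 2 \<Longrightarrow> poly_diff_op (assoc_poly d (u \<circ> cvec) k) norm_power x
                       / of_real (kelvin_c CARD('n) (m - 2 * k)) = v k (cvec x)"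
      "\<And>k x. k < p \<Longrightarrow> norm x = 1 \<Longrightarrow> CARD('n) = 2 \<Longrightarrow> poly_diff_op (assoc_poly d (u \<circ> cvec) k) log_norm x
                       / of_real (kelvin_c2 (m - 2 * k)) = v k (cvec x)"
      by (rule expand[OF u]) (rule that; assumption)
    have "T (restr ?S u) (cis (real l * pi / real p) *s cvec x) = ?Q u (cis (real l * pi / real p) *s cvec x)"
      unfolding T[OF u] using x by (simp add: restr_def rotated_spheres_point[OF l])
    also have "\<dots> = cis (real l * pi / real p) ^ m * ?Q u (cvec x)"
      by (rule hom_polys_homogeneous[OF poly_sub[OF Q_poly[OF u]]])
    also have "cis (real l * pi / real p) ^ m = cis (real m * real l * pi / real p)"
      by (simp add: Complex.DeMoivre mult.assoc)
    also have "?Q u (cvec x) = (\<Sum>k<p. v k (cvec x))"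
      using x by (simp add: v(1) square_sum_cvec)
    finally show ?thesis using v(2,3)[OF _ x1] by simp
  qed
  show ?thesis
    by (intro exI[of _ T] conjI ballI allI impI)
      (rule T orth formula[THEN conjunct1, THEN mp] formula[THEN conjunct2, THEN mp]; assumption)+
qed

end
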